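(* Let $A_1,\ldots,A_r$ be subgroups of a group $G$ such that their join $J=\big\langle\bigcup_{i=1}^r A_i\big\rangle$ in $G$ is their free product (i.e. the natural homomorphism $A_1*\cdots*A_r\to G$ is injective). Then in the HNN-extension $G*_{A_1,\ldots,A_r}(t_1,\ldots,t_r)$ the join $\big\langle\bigcup_{i=1}^r G^{t_i}\big\rangle$ is the free product of its subgroups $G^{t_1},\ldots,G^{t_r}$ (i.e. the natural homomorphism from $G^{t_1}*\cdots*G^{t_r}$ is injective). Hence the same holds in the $\ast$-construction $\mathop{\circledast}_{i=1}^{r}(K_i,L_i,t_i)_M$ whenever $G\le M\le K_1,\ldots,K_r$ are groups with $K_i\cap K_j=M$ for all distinct $i,j$, and $L_i\le K_i$ are subgroups with $G\cap L_i=A_i$ for $i=1,\ldots,r$.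
   Context: Notation: $x^y=y^{-1}xy$ and $G^y=y^{-1}Gy$. For $L\le K$, $K*_L t$ denotes the HNN-extension $\langle K,t\mid a^t=a\text{ for all }a\in L\rangle$; for groups $P,Q$ with a common subgroup $M$, $P*_M Q$ is their free product with amalgamated subgroup $M$ (via the identity map of $M$). For subgroups $A_1,\ldots,A_r\le G$, $G*_{A_1,\ldots,A_r}(t_1,\ldots,t_r)$ denotes the multiple HNN-extension $\langle G,t_1,\ldots,t_r\mid a^{t_i}=a\text{ for all }a\in A_i,\ i=1,\ldots,r\rangle$. The $\ast$-construction: given groups $M\le K_1,\ldots,K_r$ with $K_i\cap K_j=M$ for $i\ne j$ and subgroups $L_i\le K_i$, the group $\mathop{\circledast}_{i=1}^{r}(K_i,L_i,t_i)_M$ is $$\Big(\cdots\Big(\big((K_1*_{L_1}t_1)*_M(K_2*_{L_2}t_2)\big)*_M(K_3*_{L_3}t_3)\Big)\cdots\Big)*_M(K_r*_{L_r}t_r),$$ i.e. the HNN-extensions $K_i*_{L_i}t_i$ (with distinct stable letters $t_1,\ldots,t_r$) are all amalgamated in their common subgroup $M$. The group $G$ is identified with its natural image in these constructions. *)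

theory Defs
  imports "HOL-Algebra.Generated_Groups" "HOL-Algebra.Weak_Morphisms"
begin

section \<open>Group presentations\<close>

text \<open>The letter \<^term>\<open>(x, True)\<close> stands for the generator \<^term>\<open>x\<close>, and \<^term>\<open>(x, False)\<close> for its
  formal inverse. A presentation is a set of generators together with a set of defining relations,
  each of them an equation between two words in the generators.\<close>

type_synonym 'x word = "('x \<times> bool) list"
type_synonym 'x presentation = "'x set \<times> ('x word \<times> 'x word) set"

definition words :: "'x set \<Rightarrow> 'x word set"
  where "words X = lists (X \<times> UNIV)"

inductive_set word_rel :: "'x presentation \<Rightarrow> ('x word \<times> 'x word) set" for \<Delta> where
  refl: "u \<in> words (fst \<Delta>) \<Longrightarrow> (u, u) \<in> word_rel \<Delta>"
| sym: "(u, v) \<in> word_rel \<Delta> \<Longrightarrow> (v, u) \<in> word_rel \<Delta>"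
| trans: "(u, v) \<in> word_rel \<Delta> \<Longrightarrow> (v, w) \<in> word_rel \<Delta> \<Longrightarrow> (u, w) \<in> word_rel \<Delta>"
| cancel: "u \<in> words (fst \<Delta>) \<Longrightarrow> v \<in> words (fst \<Delta>) \<Longrightarrow> x \<in> fst \<Delta> \<Longrightarrow>
    (u @ [(x, b), (x, \<not> b)] @ v, u @ v) \<in> word_rel \<Delta>"
| relation: "u \<in> words (fst \<Delta>) \<Longrightarrow> v \<in> words (fst \<Delta>) \<Longrightarrow> (p, q) \<in> snd \<Delta> \<Longrightarrow>
    (u @ p @ v, u @ q @ v) \<in> word_rel \<Delta>"

definition pclass :: "'x presentation \<Rightarrow> 'x word \<Rightarrow> 'x word set"
  where "pclass \<Delta> w = word_rel \<Delta> `` {w}"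

definition pgroup :: "'x presentation \<Rightarrow> 'x word set monoid"
  where "pgroup \<Delta> =
    \<lparr>carrier = words (fst \<Delta>) // word_rel \<Delta>,
     monoid.mult = (\<lambda>C D. \<Union>u\<in>C. \<Union>v\<in>D. pclass \<Delta> (u @ v)),
     one = pclass \<Delta> []\<rparr>"

fun word_eval :: "('g, 'm) monoid_scheme \<Rightarrow> ('x \<Rightarrow> 'g) \<Rightarrow> 'x word \<Rightarrow> 'g" where
  "word_eval G \<phi> [] = \<one>\<^bsub>G\<^esub>"
| "word_eval G \<phi> ((x, b) # w) = (if b then \<phi> x else inv\<^bsub>G\<^esub> (\<phi> x)) \<otimes>\<^bsub>G\<^esub> word_eval G \<phi> w"

text \<open>The homomorphism from a presented group induced by a map \<^term>\<open>\<phi>\<close> on generators that respects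
  the relations; the choice of representative is then irrelevant (see \<open>lift_pclass\<close> below).\<close>

definition lift :: "('g, 'm) monoid_scheme \<Rightarrow> ('x \<Rightarrow> 'g) \<Rightarrow> 'x word set \<Rightarrow> 'g"
  where "lift G \<phi> C = word_eval G \<phi> (SOME w. w \<in> C)"

definition mult_table :: "('a \<Rightarrow> 'x) \<Rightarrow> ('a, 'm) monoid_scheme \<Rightarrow> ('x word \<times> 'x word) set"
  where "mult_table f G =
    {([(f a, True), (f b, True)], [(f (a \<otimes>\<^bsub>G\<^esub> b), True)]) | a b. a \<in> carrier G \<and> b \<in> carrier G}"

subsection \<open>Free products\<close>

definition free_product :: "'i set \<Rightarrow> ('i \<Rightarrow> 'a monoid) \<Rightarrow> ('i \<times> 'a) presentation"
  where "free_product I H =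
    (Sigma I (\<lambda>i. carrier (H i)), \<Union>i\<in>I. mult_table (Pair i) (H i))"

text \<open>The join of the subgroups \<open>A i\<close>, \<open>i \<in> I\<close>, is their free product: the natural homomorphism from
  the external free product is an isomorphism onto the join. It always maps onto the join, so that
  this amounts to injectivity (see \<open>join_is_free_product_iff\<close> below).\<close>

definition join_is_free_product :: "'a monoid \<Rightarrow> 'i set \<Rightarrow> ('i \<Rightarrow> 'a set) \<Rightarrow> bool"
  where "join_is_free_product G I A \<longleftrightarrow>
    lift G snd \<in> iso (pgroup (free_product I (\<lambda>i. G\<lparr>carrier := A i\<rparr>)))
                     (G\<lparr>carrier := generate G (\<Union>i\<in>I. A i)\<rparr>)"

subsection \<open>Multiple HNN-extensions\<close>

text \<open>The stable letters are indexed by \<^term>\<open>I\<close>; the relations say \<open>t\<^sub>i\<inverse> a t\<^sub>i = a\<close> for \<open>a \<in> A i\<close>.\<close>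

definition hnn_pres :: "'a monoid \<Rightarrow> 'i set \<Rightarrow> ('i \<Rightarrow> 'a set) \<Rightarrow> ('a + 'i) presentation"
  where "hnn_pres G I A =
    (Inl ` carrier G \<union> Inr ` I,
     mult_table Inl G \<union>
     {([(Inr i, False), (Inl a, True), (Inr i, True)], [(Inl a, True)]) | i a. i \<in> I \<and> a \<in> A i})"

definition hnn :: "'a monoid \<Rightarrow> 'i set \<Rightarrow> ('i \<Rightarrow> 'a set) \<Rightarrow> ('a + 'i) word set monoid"
  where "hnn G I A = pgroup (hnn_pres G I A)"

definition hnn_base :: "'a monoid \<Rightarrow> 'i set \<Rightarrow> ('i \<Rightarrow> 'a set) \<Rightarrow> 'a \<Rightarrow> ('a + 'i) word set"
  where "hnn_base G I A g = pclass (hnn_pres G I A) [(Inl g, True)]"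

definition hnn_stable :: "'a monoid \<Rightarrow> 'i set \<Rightarrow> ('i \<Rightarrow> 'a set) \<Rightarrow> 'i \<Rightarrow> ('a + 'i) word set"
  where "hnn_stable G I A i = pclass (hnn_pres G I A) [(Inr i, True)]"

subsection \<open>Amalgamated free products\<close>

text \<open>The amalgamated subgroup is given as a set \<^term>\<open>M\<close> with its two embeddings \<^term>\<open>\<alpha>\<close> into \<^term>\<open>P\<close>
  and \<^term>\<open>\<beta>\<close> into \<^term>\<open>Q\<close>.\<close>

definition amalgam_pres ::
    "'p monoid \<Rightarrow> 'q monoid \<Rightarrow> 'm set \<Rightarrow> ('m \<Rightarrow> 'p) \<Rightarrow> ('m \<Rightarrow> 'q) \<Rightarrow> ('p + 'q) presentation"
  where "amalgam_pres P Q M \<alpha> \<beta> =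
    (Inl ` carrier P \<union> Inr ` carrier Q,
     mult_table Inl P \<union> mult_table Inr Q \<union>
     {([(Inl (\<alpha> m), True)], [(Inr (\<beta> m), True)]) | m. m \<in> M})"

text \<open>Iterating the binary amalgam \<open>P *\<^sub>M Q\<close> changes the type of the group elements in each step.
  The following type accommodates all stages of the iteration; \<open>Amalg\<close> takes a representative word
  of an element of an amalgam in which the left factor is the previous stage and the right factor
  is a new group with elements of type \<open>'b\<close>.\<close>

datatype 'b amalg_elem = Factor 'b | Amalg "(('b amalg_elem + 'b) \<times> bool) list"

definition encode :: "('b amalg_elem + 'b) word set \<Rightarrow> 'b amalg_elem"
  where "encode C = Amalg (SOME w. w \<in> C)"

text \<open>\<^term>\<open>iter_amalgam M e P r\<close> is the group \<open>(\<dots>((P\<^sub>1 *\<^sub>M P\<^sub>2) *\<^sub>M P\<^sub>3) \<dots>) *\<^sub>M P\<^sub>r\<close> (for \<open>r \<ge> 1\<close>), paired with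
  the natural maps from \<open>P\<^sub>i\<close> to it (for \<open>1 \<le> i \<le> r\<close>). Here \<open>e i\<close> is the embedding of \<open>M\<close> into \<open>P\<^sub>i\<close>.
  In each step, \<open>M\<close> is regarded as a subgroup of the previous stage through \<open>P\<^sub>1\<close>.\<close>

fun iter_amalgam :: "'m set \<Rightarrow> (nat \<Rightarrow> 'm \<Rightarrow> 'b) \<Rightarrow> (nat \<Rightarrow> 'b monoid) \<Rightarrow> nat \<Rightarrow>
    'b amalg_elem monoid \<times> (nat \<Rightarrow> 'b \<Rightarrow> 'b amalg_elem)" where
  "iter_amalgam M e P (Suc 0) = (image_group Factor (P 1), \<lambda>i. Factor)"
| "iter_amalgam M e P (Suc (Suc n)) =
    (let S = fst (iter_amalgam M e P (Suc n));
         \<iota> = snd (iter_amalgam M e P (Suc n));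
         \<Delta> = amalgam_pres S (P (Suc (Suc n))) M (\<lambda>m. \<iota> 1 (e 1 m)) (e (Suc (Suc n)))
     in (image_group encode (pgroup \<Delta>),
         \<lambda>i x. encode (pclass \<Delta> [(if i = Suc (Suc n) then Inr x else Inl (\<iota> i x), True)])))"

section \<open>The star-construction\<close>

text \<open>The stable letter of \<open>K i *\<^bsub>L i\<^esub> t\<^sub>i\<close> is indexed by \<open>i\<close>, so that the stable letters are distinct.\<close>

definition star_factor ::
    "(nat \<Rightarrow> 'a monoid) \<Rightarrow> (nat \<Rightarrow> 'a set) \<Rightarrow> nat \<Rightarrow> ('a + nat) word set monoid"
  where "star_factor K L i = hnn (K i) {i} L"

definition star_iter :: "'a monoid \<Rightarrow> (nat \<Rightarrow> 'a monoid) \<Rightarrow> (nat \<Rightarrow> 'a set) \<Rightarrow> nat \<Rightarrow>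
    ('a + nat) word set amalg_elem monoid \<times>
    (nat \<Rightarrow> ('a + nat) word set \<Rightarrow> ('a + nat) word set amalg_elem)"
  where "star_iter M K L r =
    iter_amalgam (carrier M) (\<lambda>i. hnn_base (K i) {i} L) (star_factor K L) r"

definition star :: "'a monoid \<Rightarrow> (nat \<Rightarrow> 'a monoid) \<Rightarrow> (nat \<Rightarrow> 'a set) \<Rightarrow> nat \<Rightarrow>
    ('a + nat) word set amalg_elem monoid"
  where "star M K L r = fst (star_iter M K L r)"

definition star_base :: "'a monoid \<Rightarrow> (nat \<Rightarrow> 'a monoid) \<Rightarrow> (nat \<Rightarrow> 'a set) \<Rightarrow> nat \<Rightarrow>
    'a \<Rightarrow> ('a + nat) word set amalg_elem"
  where "star_base M K L r m = snd (star_iter M K L r) 1 (hnn_base (K 1) {1} L m)"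

definition star_stable :: "'a monoid \<Rightarrow> (nat \<Rightarrow> 'a monoid) \<Rightarrow> (nat \<Rightarrow> 'a set) \<Rightarrow> nat \<Rightarrow>
    nat \<Rightarrow> ('a + nat) word set amalg_elem"
  where "star_stable M K L r i = snd (star_iter M K L r) i (hnn_stable (K i) {i} L i)"

section \<open>Conjugates and subgroups\<close>

definition conjugate :: "('a, 'm) monoid_scheme \<Rightarrow> 'a set \<Rightarrow> 'a \<Rightarrow> 'a set"
  where "conjugate G H y = (\<lambda>x. inv\<^bsub>G\<^esub> y \<otimes>\<^bsub>G\<^esub> x \<otimes>\<^bsub>G\<^esub> y) ` H"

text \<open>\<open>H \<le> G\<close> for two groups as structures; the operations need to agree only on the carrier
  of \<^term>\<open>H\<close>.\<close>

definition group_le :: "'a monoid \<Rightarrow> 'a monoid \<Rightarrow> bool"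
  where "group_le H G \<longleftrightarrow> group H \<and> group G \<and> carrier H \<subseteq> carrier G \<and>
    (\<forall>x\<in>carrier H. \<forall>y\<in>carrier H. x \<otimes>\<^bsub>H\<^esub> y = x \<otimes>\<^bsub>G\<^esub> y)"

section \<open>Basic facts\<close>

definition wf_pres :: "'x presentation \<Rightarrow> bool"
  where "wf_pres \<Delta> \<longleftrightarrow> snd \<Delta> \<subseteq> words (fst \<Delta>) \<times> words (fst \<Delta>)"

lemma words_simps [simp]:
  "[] \<in> words X"
  "(a # w) \<in> words X \<longleftrightarrow> fst a \<in> X \<and> w \<in> words X"
  "u @ v \<in> words X \<longleftrightarrow> u \<in> words X \<and> v \<in> words X"
  by (auto simp: words_def mem_Times_iff)

lemma word_rel_words:
  assumes "wf_pres \<Delta>" "(u, v) \<in> word_rel \<Delta>"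
  shows "u \<in> words (fst \<Delta>) \<and> v \<in> words (fst \<Delta>)"
  using assms(2,1) by induction (auto simp: wf_pres_def)

lemma equiv_word_rel:
  assumes "wf_pres \<Delta>" shows "equiv (words (fst \<Delta>)) (word_rel \<Delta>)"
  using word_rel_words[OF assms]
  by (auto intro!: equivI refl_onI symI transI intro: word_rel.intros)

lemma word_rel_append:
  assumes "wf_pres \<Delta>" "(u, u') \<in> word_rel \<Delta>" "(v, v') \<in> word_rel \<Delta>"
  shows "(u @ v, u' @ v') \<in> word_rel \<Delta>"
proof -
  have l: "(u @ w, u' @ w) \<in> word_rel \<Delta>" if "w \<in> words (fst \<Delta>)" for w
    using assms(2) that
  proof induction
    case (cancel u v x b)
    then show ?case using word_rel.cancel[of u \<Delta> "v @ w" x b] by simp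
  next
    case (relation u v p q)
    then show ?case using word_rel.relation[of u \<Delta> "v @ w" p q] by simp
  qed (auto intro: word_rel.intros)
  have r: "(w @ v, w @ v') \<in> word_rel \<Delta>" if "w \<in> words (fst \<Delta>)" for w
    using assms(3) that
  proof induction
    case (cancel u v x b)
    then show ?case using word_rel.cancel[of "w @ u" \<Delta> v x b] by simp
  next
    case (relation u v p q)
    then show ?case using word_rel.relation[of "w @ u" \<Delta> v p q] by simp
  qed (auto intro: word_rel.intros)
  show ?thesis
    using l r word_rel_words[OF assms(1)] assms(2,3) word_rel.trans by metis
qed

lemma pclass_eq_iff:
  assumes "wf_pres \<Delta>" "u \<in> words (fst \<Delta>)" "v \<in> words (fst \<Delta>)"
  shows "pclass \<Delta> u = pclass \<Delta> v \<longleftrightarrow> (u, v) \<in> word_rel \<Delta>"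
  unfolding pclass_def using eq_equiv_class_iff[OF equiv_word_rel[OF assms(1)]] assms by blast

lemma carrier_pgroup: "carrier (pgroup \<Delta>) = pclass \<Delta> ` words (fst \<Delta>)"
  by (auto simp: pgroup_def pclass_def quotient_def)

lemma mult_pgroup:
  assumes "wf_pres \<Delta>" "u \<in> words (fst \<Delta>)" "v \<in> words (fst \<Delta>)"
  shows "pclass \<Delta> u \<otimes>\<^bsub>pgroup \<Delta>\<^esub> pclass \<Delta> v = pclass \<Delta> (u @ v)"
proof -
  have "pclass \<Delta> (u' @ v') = pclass \<Delta> (u @ v)" if "u' \<in> pclass \<Delta> u" "v' \<in> pclass \<Delta> v" for u' v'
  proof -
    have "(u, u') \<in> word_rel \<Delta>" "(v, v') \<in> word_rel \<Delta>" using that by (auto simp: pclass_def)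
    then have "(u' @ v', u @ v) \<in> word_rel \<Delta>"
      using assms(1) by (blast intro: word_rel_append word_rel.sym)
    then show ?thesis using pclass_eq_iff[OF assms(1)] word_rel_words[OF assms(1)] by metis
  qed
  moreover have "u \<in> pclass \<Delta> u" "v \<in> pclass \<Delta> v"
    using assms by (auto simp: pclass_def intro: word_rel.refl)
  ultimately have "(\<Union>u'\<in>pclass \<Delta> u. \<Union>v'\<in>pclass \<Delta> v. pclass \<Delta> (u' @ v')) = pclass \<Delta> (u @ v)"
    by blast
  then show ?thesis by (simp add: pgroup_def)
qed

lemma one_pgroup: "\<one>\<^bsub>pgroup \<Delta>\<^esub> = pclass \<Delta> []"
  by (simp add: pgroup_def)

lemma word_rel_inverse:
  assumes "w \<in> words (fst \<Delta>)"
  shows "(rev (map (\<lambda>(x, b). (x, \<not> b)) w) @ w, []) \<in> word_rel \<Delta>"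
  using assms
proof (induction w)
  case Nil
  then show ?case by (auto intro: word_rel.refl)
next
  case (Cons a w)
  obtain x b where a: "a = (x, b)" by (cases a)
  let ?w' = "rev (map (\<lambda>(x, b). (x, \<not> b)) w)"
  have "w' \<in> words X \<Longrightarrow> rev (map (\<lambda>(x, b). (x, \<not> b)) w') \<in> words X"
    for X and w' :: "'a word"
    by (induction w') auto
  then have "?w' \<in> words (fst \<Delta>)" using Cons.prems by simp
  then have "(?w' @ [(x, \<not> b), (x, \<not> \<not> b)] @ w, ?w' @ w) \<in> word_rel \<Delta>"
    using Cons.prems a by (intro word_rel.cancel) auto
  moreover have "(?w' @ w, []) \<in> word_rel \<Delta>" using Cons by simp
  ultimately have "(?w' @ [(x, \<not> b), (x, \<not> \<not> b)] @ w, []) \<in> word_rel \<Delta>" by (rule word_rel.trans)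
  then show ?case using a by simp
qed

lemma group_pgroup:
  assumes "wf_pres \<Delta>" shows "group (pgroup \<Delta>)"
proof (rule groupI)
  show "\<exists>y\<in>carrier (pgroup \<Delta>). y \<otimes>\<^bsub>pgroup \<Delta>\<^esub> x = \<one>\<^bsub>pgroup \<Delta>\<^esub>"
    if x: "x \<in> carrier (pgroup \<Delta>)" for x
  proof -
    obtain w where w: "w \<in> words (fst \<Delta>)" "x = pclass \<Delta> w" using x by (auto simp: carrier_pgroup)
    let ?v = "rev (map (\<lambda>(x, b). (x, \<not> b)) w)"
    have "?v \<in> words (fst \<Delta>)"
      using word_rel_words[OF assms word_rel_inverse[OF w(1)]] by simp
    moreover have "pclass \<Delta> (?v @ w) = pclass \<Delta> []"
      using pclass_eq_iff[OF assms] word_rel_inverse[OF w(1)] word_rel_words[OF assms] by metis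
    ultimately show ?thesis
      using w mult_pgroup[OF assms, of ?v w] unfolding carrier_pgroup one_pgroup by auto
  qed
next
  fix x y z assume "x \<in> carrier (pgroup \<Delta>)" "y \<in> carrier (pgroup \<Delta>)" "z \<in> carrier (pgroup \<Delta>)"
  then obtain u v w where w: "u \<in> words (fst \<Delta>)" "v \<in> words (fst \<Delta>)" "w \<in> words (fst \<Delta>)"
    and x: "x = pclass \<Delta> u" "y = pclass \<Delta> v" "z = pclass \<Delta> w"
    unfolding carrier_pgroup by blast
  have "u @ v \<in> words (fst \<Delta>)" using w by simp
  then show "x \<otimes>\<^bsub>pgroup \<Delta>\<^esub> y \<in> carrier (pgroup \<Delta>)"
    unfolding x mult_pgroup[OF assms w(1,2)] carrier_pgroup by (rule imageI)
  show "x \<otimes>\<^bsub>pgroup \<Delta>\<^esub> y \<otimes>\<^bsub>pgroup \<Delta>\<^esub> z = x \<otimes>\<^bsub>pgroup \<Delta>\<^esub> (y \<otimes>\<^bsub>pgroup \<Delta>\<^esub> z)"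
    using w x mult_pgroup[OF assms] by simp
next
  fix x assume "x \<in> carrier (pgroup \<Delta>)"
  then obtain u where u: "u \<in> words (fst \<Delta>)" "x = pclass \<Delta> u" unfolding carrier_pgroup by blast
  show "\<one>\<^bsub>pgroup \<Delta>\<^esub> \<otimes>\<^bsub>pgroup \<Delta>\<^esub> x = x"
    using u mult_pgroup[OF assms, of "[]" u] by (simp add: one_pgroup)
next
  show "\<one>\<^bsub>pgroup \<Delta>\<^esub> \<in> carrier (pgroup \<Delta>)"
    unfolding carrier_pgroup one_pgroup by (rule imageI) simp
qed

lemma (in group) word_eval_closed:
  assumes "\<phi> \<in> X \<rightarrow> carrier G" "w \<in> words X"
  shows "word_eval G \<phi> w \<in> carrier G"
  using assms(2)
proof (induction w)
  case (Cons a w)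
  obtain x b where a: "a = (x, b)" by (cases a)
  have "\<phi> x \<in> carrier G" using Cons.prems a assms(1) by auto
  then show ?case using Cons a by simp
qed simp

lemma (in group) word_eval_append:
  assumes "\<phi> \<in> X \<rightarrow> carrier G" "u \<in> words X" "v \<in> words X"
  shows "word_eval G \<phi> (u @ v) = word_eval G \<phi> u \<otimes> word_eval G \<phi> v"
  using assms(2)
proof (induction u)
  case Nil
  then show ?case using word_eval_closed[OF assms(1,3)] by simp
next
  case (Cons a u)
  obtain x b where a: "a = (x, b)" by (cases a)
  have "\<phi> x \<in> carrier G" "u \<in> words X" using Cons.prems a assms(1) by auto
  then show ?case
    using word_eval_closed[OF assms(1)] assms(3) Cons.IH a by (simp add: m_assoc)
qed

definition compatible :: "('g, 'm) monoid_scheme \<Rightarrow> 'x presentation \<Rightarrow> ('x \<Rightarrow> 'g) \<Rightarrow> bool"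
  where "compatible G \<Delta> \<phi> \<longleftrightarrow> \<phi> \<in> fst \<Delta> \<rightarrow> carrier G \<and>
    (\<forall>(p, q)\<in>snd \<Delta>. word_eval G \<phi> p = word_eval G \<phi> q)"

lemma (in group) word_eval_word_rel:
  assumes "wf_pres \<Delta>" "compatible G \<Delta> \<phi>" "(u, v) \<in> word_rel \<Delta>"
  shows "word_eval G \<phi> u = word_eval G \<phi> v"
  using assms(3)
proof induction
  case (cancel u v x b)
  have \<phi>: "\<phi> \<in> fst \<Delta> \<rightarrow> carrier G" using assms(2) by (simp add: compatible_def)
  have x: "\<phi> x \<in> carrier G" using \<phi> cancel by auto
  have "word_eval G \<phi> ([(x, b), (x, \<not> b)] @ v) = word_eval G \<phi> v"
    using x word_eval_closed[OF \<phi> cancel(2)] by (simp add: m_assoc[symmetric])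
  moreover have "[(x, b), (x, \<not> b)] @ v \<in> words (fst \<Delta>)" using cancel by simp
  ultimately show ?case using word_eval_append[OF \<phi> cancel(1)] cancel(2) by metis
next
  case (relation u v p q)
  have \<phi>: "\<phi> \<in> fst \<Delta> \<rightarrow> carrier G" using assms(2) by (simp add: compatible_def)
  have "p \<in> words (fst \<Delta>)" "q \<in> words (fst \<Delta>)" using relation assms(1) by (auto simp: wf_pres_def)
  moreover have "word_eval G \<phi> p = word_eval G \<phi> q"
    using relation(3) assms(2) by (auto simp: compatible_def)
  ultimately show ?case using relation(1,2) word_eval_append[OF \<phi>] by simp
qed auto

lemma (in group) lift_pclass:
  assumes "wf_pres \<Delta>" "compatible G \<Delta> \<phi>" "w \<in> words (fst \<Delta>)"
  shows "lift G \<phi> (pclass \<Delta> w) = word_eval G \<phi> w"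
proof -
  have "w \<in> pclass \<Delta> w" using assms(3) by (simp add: pclass_def word_rel.refl)
  then have "(SOME w'. w' \<in> pclass \<Delta> w) \<in> pclass \<Delta> w" by (rule someI)
  then have "(w, SOME w'. w' \<in> pclass \<Delta> w) \<in> word_rel \<Delta>" by (simp add: pclass_def)
  then show ?thesis unfolding lift_def using word_eval_word_rel[OF assms(1,2)] by metis
qed

lemma (in group) lift_hom:
  assumes "wf_pres \<Delta>" "compatible G \<Delta> \<phi>"
  shows "lift G \<phi> \<in> hom (pgroup \<Delta>) G"
proof -
  have \<phi>: "\<phi> \<in> fst \<Delta> \<rightarrow> carrier G" using assms(2) by (simp add: compatible_def)
  show ?thesis
    by (rule homI) (auto simp: carrier_pgroup mult_pgroup[OF assms(1)] lift_pclass[OF assms]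
        word_eval_append[OF \<phi>] word_eval_closed[OF \<phi>])
qed

lemma wf_free_product:
  assumes "\<And>i. i \<in> I \<Longrightarrow> group (H i)" shows "wf_pres (free_product I H)"
proof -
  have "a \<otimes>\<^bsub>H i\<^esub> b \<in> carrier (H i)" if "i \<in> I" "a \<in> carrier (H i)" "b \<in> carrier (H i)" for i a b
    using that assms group.is_monoid monoid.m_closed by metis
  then show ?thesis by (auto simp: wf_pres_def free_product_def mult_table_def)
qed

lemma wf_hnn_pres:
  assumes "group G" "\<And>i. i \<in> I \<Longrightarrow> A i \<subseteq> carrier G" shows "wf_pres (hnn_pres G I A)"
proof -
  interpret group G by fact
  have "a \<in> carrier G" if "i \<in> I" "a \<in> A i" for i a using assms(2) that by blast
  then show ?thesis by (auto simp: wf_pres_def hnn_pres_def mult_table_def)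
qed

lemma wf_amalgam_pres:
  assumes "group P" "group Q" "\<alpha> \<in> M \<rightarrow> carrier P" "\<beta> \<in> M \<rightarrow> carrier Q"
  shows "wf_pres (amalgam_pres P Q M \<alpha> \<beta>)"
proof -
  interpret P: group P by fact
  interpret Q: group Q by fact
  show ?thesis using assms(3,4)
    by (auto simp: wf_pres_def amalgam_pres_def mult_table_def Pi_iff)
qed

lemma inj_on_encode:
  assumes "wf_pres \<Delta>" shows "inj_on encode (carrier (pgroup \<Delta>))"
proof (rule inj_onI)
  fix C D assume C: "C \<in> carrier (pgroup \<Delta>)" and D: "D \<in> carrier (pgroup \<Delta>)"
    and eq: "encode C = encode D"
  note e = equiv_word_rel[OF assms]
  have CD: "C \<in> words (fst \<Delta>) // word_rel \<Delta>" "D \<in> words (fst \<Delta>) // word_rel \<Delta>"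
    using C D by (auto simp: pgroup_def)
  then have "(SOME w. w \<in> C) \<in> C" "(SOME w. w \<in> D) \<in> D"
    using in_quotient_imp_non_empty[OF e] by (meson ex_in_conv someI_ex)+
  then show "C = D" using eq quotient_disj[OF e CD] by (auto simp: encode_def)
qed

lemma group_iter_amalgam:
  assumes "\<And>i. group (P i)" "\<And>i. e i \<in> M \<rightarrow> carrier (P i)" "n \<ge> 1"
  shows "group (fst (iter_amalgam M e P n)) \<and>
    (\<forall>i\<in>{1..n}. snd (iter_amalgam M e P n) i \<in> carrier (P i) \<rightarrow> carrier (fst (iter_amalgam M e P n)))"
  using assms(3)
proof (induction n rule: dec_induct)
  case base
  have "group (image_group Factor (P 1))"
    by (rule group.inj_imp_image_group_is_group[OF assms(1)]) (auto intro: inj_onI)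
  then show ?case by (simp add: image_group_carrier)
next
  case (step n)
  then obtain k where k: "n = Suc k" by (cases n) auto
  let ?S = "fst (iter_amalgam M e P (Suc k))" and ?\<iota> = "snd (iter_amalgam M e P (Suc k))"
  let ?\<Delta> = "amalgam_pres ?S (P (Suc (Suc k))) M (\<lambda>m. ?\<iota> 1 (e 1 m)) (e (Suc (Suc k)))"
  have IH: "group ?S" "\<And>i. i \<in> {1..Suc k} \<Longrightarrow> ?\<iota> i \<in> carrier (P i) \<rightarrow> carrier ?S"
    using step.IH k by auto
  have wf: "wf_pres ?\<Delta>"
    using IH(2)[of 1] assms(2)[of 1] assms(1,2) IH(1) by (intro wf_amalgam_pres) auto
  have "group (image_group encode (pgroup ?\<Delta>))"
    by (rule group.inj_imp_image_group_is_group[OF group_pgroup[OF wf] inj_on_encode[OF wf]])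
  moreover have "encode (pclass ?\<Delta> [(if i = Suc (Suc k) then Inr x else Inl (?\<iota> i x), True)])
      \<in> carrier (image_group encode (pgroup ?\<Delta>))"
    if "i \<in> {1..Suc (Suc k)}" "x \<in> carrier (P i)" for i x
    using that IH(2)[of i]
    by (auto simp: image_group_carrier carrier_pgroup amalgam_pres_def intro!: imageI)
  ultimately show ?case unfolding k iter_amalgam.simps Let_def by simp
qed

lemma join_is_free_product_iff:
  assumes "group G" "\<And>i. i \<in> I \<Longrightarrow> subgroup (A i) G"
  shows "join_is_free_product G I A \<longleftrightarrow>
    inj_on (lift G snd) (carrier (pgroup (free_product I (\<lambda>i. G\<lparr>carrier := A i\<rparr>))))"
proof -
  interpret group G by fact
  let ?\<Delta> = "free_product I (\<lambda>i. G\<lparr>carrier := A i\<rparr>)"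
  let ?J = "generate G (\<Union>i\<in>I. A i)"
  have wf: "wf_pres ?\<Delta>"
    using assms(2) by (intro wf_free_product) (auto intro: subgroup_imp_group)
  have mem: "a \<in> carrier G" if "i \<in> I" "a \<in> A i" for i a
    using assms(2) that subgroup.mem_carrier by metis
  then have resp: "compatible G ?\<Delta> snd"
    by (auto simp: compatible_def free_product_def mult_table_def)
  have sub: "(\<Union>i\<in>I. A i) \<subseteq> carrier G" using assms(2) subgroup.subset by blast
  note hom = lift_hom[OF wf resp]
  have in_J: "word_eval G snd w \<in> ?J" if "w \<in> words (fst ?\<Delta>)" for w
    using that
  proof (induction w)
    case Nil
    then show ?case by (simp add: generate.one)
  next
    case (Cons a w)
    obtain i x b where a: "a = ((i, x), b)" by (metis prod.exhaust)
    then have x: "x \<in> (\<Union>i\<in>I. A i)" using Cons.prems by (auto simp: free_product_def)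
    then show ?case using Cons a
      by (auto intro: generate.eng generate.incl[OF x] generate.inv[OF x])
  qed
  have onto: "\<exists>w\<in>words (fst ?\<Delta>). word_eval G snd w = y" if "y \<in> ?J" for y
    using that
  proof (induction y)
    case one
    then show ?case by (intro bexI[of _ "[]"]) auto
  next
    case (incl h)
    then obtain i where "i \<in> I" "h \<in> A i" by auto
    then show ?case using sub by (intro bexI[of _ "[((i, h), True)]"]) (auto simp: free_product_def)
  next
    case (inv h)
    then obtain i where "i \<in> I" "h \<in> A i" by auto
    then show ?case using sub by (intro bexI[of _ "[((i, h), False)]"]) (auto simp: free_product_def)
  next
    case (eng h1 h2)
    then obtain u v where "u \<in> words (fst ?\<Delta>)" "v \<in> words (fst ?\<Delta>)"
      "word_eval G snd u = h1" "word_eval G snd v = h2" by blast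
    then show ?case using resp
      by (intro bexI[of _ "u @ v"]) (auto simp: compatible_def word_eval_append)
  qed
  have img: "lift G snd ` carrier (pgroup ?\<Delta>) = ?J"
    unfolding carrier_pgroup image_image
    using in_J onto by (force simp: lift_pclass[OF wf resp])
  then have "lift G snd \<in> hom (pgroup ?\<Delta>) (G\<lparr>carrier := ?J\<rparr>)"
    using hom by (auto simp: hom_def)
  then show ?thesis using img by (auto simp: join_is_free_product_def iso_def bij_betw_def)
qed

end

theory Submission
  imports Defs "HOL-Algebra.Bij"
begin

text \<open>Write \<open>g\<^sup>t = t\<inverse> g t\<close>. A product of elements \<open>g\<^sup>t\<close>, with consecutive stable letters distinct and
  all \<open>g\<close> nontrivial, has to be shown to be nontrivial, both in the HNN-extension and in the
  \<open>\<ast>\<close>-construction. It suffices to find a homomorphism to a permutation group under which the image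
  of such a product moves some point. The presentations are thus used only through their universal
  properties, and no normal form theorem for HNN-extensions or amalgams is involved.

  The permutations play ping-pong. Let \<open>M\<close> and all \<open>K i\<close> act on a set \<open>\<Omega>\<close>, with the actions of the
  \<open>K i\<close> extending that of \<open>M\<close>, and let \<open>t i\<close> act by an involution \<open>\<tau> i\<close> that commutes with \<open>L i\<close>
  and exchanges an \<open>L i\<close>-invariant set \<open>Y i\<close> with its complement. Suppose that all \<open>g \<in> G\<close> outside
  \<open>A i = G \<inter> L i\<close> move \<open>Y i\<close> off itself. For \<open>t = t i\<close> and such a \<open>g\<close>, the conjugate \<open>g\<^sup>t\<close> then
  maps the complement of \<open>Y i\<close> into \<open>Y i\<close>. If \<open>a \<in> A i\<close>, then \<open>a\<^sup>t = a\<close>. In a reduced product, any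
  two consecutive factors of the first kind are therefore separated by an element \<open>b\<close> of the join
  of the \<open>A i\<close>. When the two factors belong to different indices, it is enough that the translates
  of \<open>Y i\<close> and \<open>Y j\<close> under \<open>G\<close> are disjoint; when they belong to the same index \<open>i\<close>, it is needed
  that \<open>b\<close> is not in \<open>A i\<close>, and this is what the freeness of the join of the \<open>A i\<close> gives
  (\<open>reduced_product_notin\<close>). A point outside all translates of the \<open>Y i\<close> whose stabilizer in \<open>G\<close> is
  trivial is then moved by every nontrivial reduced product (\<open>conj_eval_nontrivial\<close>).

  Such actions exist because a free action of a group is determined up to isomorphism by its number
  of orbits, which can be made the same for all groups in question (\<open>free_action_trivialization\<close>).
  The free \<open>M\<close>-set \<open>M \<times> Z\<close>, for \<open>Z\<close> large, is isomorphic to \<open>K i \<times> Z\<close> as an \<open>M\<close>-set, so that the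
  action of \<open>M\<close> on it extends to \<open>K i\<close>. The set \<open>\<Omega>\<close> consists of several such sheets, and \<open>Y i\<close> is the
  part \<open>L i \<times> Z\<close> of \<open>K i \<times> Z\<close> in one of them; it is isomorphic to its complement as an \<open>L i\<close>-set,
  and \<open>\<tau> i\<close> is this isomorphism together with its inverse (\<open>sheet_extension\<close>).

  The HNN-extension of \<open>G\<close> itself is represented by the same permutations, for \<open>M = K i = G\<close> and
  \<open>L i = A i\<close>. A further case, with all \<open>L i\<close> trivial, gives the fact that nonempty reduced words
  represent nontrivial elements of a free product; it is needed to exploit the assumption about the
  join of the \<open>A i\<close> (\<open>join_is_free_productD\<close>).\<close>

section \<open>Free group actions\<close>

definition free_action ::
    "('a, 'm) monoid_scheme \<Rightarrow> 's set \<Rightarrow> ('a \<Rightarrow> 's \<Rightarrow> 's) \<Rightarrow> bool"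
  where "free_action L S a \<longleftrightarrow>
    (\<forall>l\<in>carrier L. \<forall>x\<in>S. a l x \<in> S \<and> (a l x = x \<longrightarrow> l = \<one>\<^bsub>L\<^esub>)) \<and>
    (\<forall>x\<in>S. a \<one>\<^bsub>L\<^esub> x = x) \<and>
    (\<forall>l\<in>carrier L. \<forall>l'\<in>carrier L. \<forall>x\<in>S. a (l \<otimes>\<^bsub>L\<^esub> l') x = a l (a l' x))"

text \<open>A set \<open>D\<close> of orbit representatives is a basis of a free \<open>G\<close>-set.\<close>

lemma (in group) free_action_orbits:
  assumes "free_action G S a"
  shows "\<exists>D\<subseteq>S. bij_betw (\<lambda>(l, d). a l d) (carrier G \<times> D) S"
proof -
  have closed: "a l x \<in> S" and free: "a l x = x \<Longrightarrow> l = \<one>"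
    if "l \<in> carrier G" "x \<in> S" for l x
    using that assms by (auto simp: free_action_def)
  have one: "a \<one> x = x" if "x \<in> S" for x
    using that assms by (auto simp: free_action_def)
  have mult: "a (l \<otimes> l') x = a l (a l' x)"
    if "l \<in> carrier G" "l' \<in> carrier G" "x \<in> S" for l l' x
    using that assms by (auto simp: free_action_def)
  have inv: "a (inv l) (a l x) = x" if "l \<in> carrier G" "x \<in> S" for l x
    using mult[of "inv l" l x] that one by simp
  define orb where "orb x = (\<lambda>l. a l x) ` carrier G" for x
  define rep where "rep x = (SOME y. y \<in> orb x)" for x
  have orb_eq: "orb (a l x) = orb x" if "l \<in> carrier G" "x \<in> S" for l x
  proof
    show "orb (a l x) \<subseteq> orb x"
    proof
      fix y assume "y \<in> orb (a l x)"
      then obtain l' where "l' \<in> carrier G" "y = a l' (a l x)" by (auto simp: orb_def)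
      then have "y = a (l' \<otimes> l) x" "l' \<otimes> l \<in> carrier G" using mult that by auto
      then show "y \<in> orb x" by (auto simp: orb_def)
    qed
    show "orb x \<subseteq> orb (a l x)"
    proof
      fix y assume "y \<in> orb x"
      then obtain l' where l': "l' \<in> carrier G" "y = a l' x" by (auto simp: orb_def)
      then have "y = a (l' \<otimes> inv l) (a l x)" "l' \<otimes> inv l \<in> carrier G"
        using mult[of l' "inv l" "a l x"] inv that closed by auto
      then show "y \<in> orb (a l x)" by (auto simp: orb_def)
    qed
  qed
  have rep_in: "rep x \<in> orb x" if "x \<in> S" for x
    unfolding rep_def by (rule someI[of _ "a \<one> x"]) (auto simp: orb_def)
  have rep_eq: "rep (a l x) = rep x" if "l \<in> carrier G" "x \<in> S" for l x
    using orb_eq[OF that] by (simp add: rep_def)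
  have rep_S: "rep x \<in> S" if "x \<in> S" for x
    using rep_in[OF that] closed that by (auto simp: orb_def)
  have rep_rep: "rep (rep x) = rep x" if "x \<in> S" for x
  proof -
    obtain l where "l \<in> carrier G" "rep x = a l x"
      using rep_in[OF \<open>x \<in> S\<close>] by (auto simp: orb_def)
    then show ?thesis using rep_eq that by metis
  qed
  have "bij_betw (\<lambda>(l, d). a l d) (carrier G \<times> rep ` S) S"
  proof (rule bij_betw_imageI)
    show "inj_on (\<lambda>(l, d). a l d) (carrier G \<times> rep ` S)"
    proof (rule inj_onI, clarify)
      fix l l' x x'
      assume l: "l \<in> carrier G" "l' \<in> carrier G" and x: "x \<in> S" "x' \<in> S"
        and eq: "a l (rep x) = a l' (rep x')"
      have "rep x = rep x'"
        using rep_eq[OF l(1) rep_S[OF x(1)]] rep_eq[OF l(2) rep_S[OF x(2)]] rep_rep x eq by simp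
      moreover from this have "a (inv l' \<otimes> l) (rep x) = rep x"
        using mult[of "inv l'" l "rep x"] l x rep_S inv eq by simp
      then have "inv l' \<otimes> l = \<one>" using free[of "inv l' \<otimes> l" "rep x"] l rep_S x by simp
      then have "l = l'" using l by (metis inv_closed inv_equality inv_inv)
      ultimately show "l = l' \<and> rep x = rep x'" by simp
    qed
    show "(\<lambda>(l, d). a l d) ` (carrier G \<times> rep ` S) = S"
    proof
      show "(\<lambda>(l, d). a l d) ` (carrier G \<times> rep ` S) \<subseteq> S" using closed rep_S by auto
      show "S \<subseteq> (\<lambda>(l, d). a l d) ` (carrier G \<times> rep ` S)"
      proof
        fix x assume x: "x \<in> S"
        then obtain l where l: "l \<in> carrier G" "rep x = a l x"
          using rep_in by (auto simp: orb_def)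
        then have "x = a (inv l) (rep x)" using inv x by simp
        then show "x \<in> (\<lambda>(l, d). a l d) ` (carrier G \<times> rep ` S)"
          using l(1) x by (intro image_eqI[of _ _ "(inv l, rep x)"]) simp_all
      qed
    qed
  qed
  then show ?thesis using rep_S by (intro exI[of _ "rep ` S"]) auto
qed

text \<open>The injection \<open>j\<close> says that \<open>Z\<close> absorbs the factor \<open>S\<close>. Hence the number of orbits in \<open>S \<times> Z\<close> is the
cardinality of \<open>Z\<close>, whatever the number of orbits in \<open>S\<close> is, and all free \<open>G\<close>-sets of
this form are isomorphic to \<open>G \<times> Z\<close>.\<close>

lemma (in group) free_action_trivialization:
  fixes S :: "'s set" and a :: "'a \<Rightarrow> 's \<Rightarrow> 's" and j :: "'s \<times> 'z \<Rightarrow> 'z"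
  assumes a: "free_action G S a" and "S \<noteq> {}" and j: "inj j"
  shows "\<exists>h. bij_betw h (carrier G \<times> (UNIV :: 'z set)) (S \<times> (UNIV :: 'z set)) \<and>
    (\<forall>l\<in>carrier G. \<forall>l'\<in>carrier G. \<forall>z. h (l \<otimes> l', z) = map_prod (a l) id (h (l', z)))"
proof -
  obtain D where D: "D \<subseteq> S" and bij: "bij_betw (\<lambda>(l, d). a l d) (carrier G \<times> D) S"
    using free_action_orbits[OF a] by auto
  have "D \<noteq> {}" using bij \<open>S \<noteq> {}\<close> by (auto simp: bij_betw_def)
  then obtain d where d: "d \<in> D" by blast
  \<comment> \<open>\<^term>\<open>D \<times> UNIV\<close> is a basis of \<^term>\<open>S \<times> UNIV\<close>, and it is equinumerous to \<^term>\<open>UNIV :: 'z set\<close>\<close>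
  obtain b :: "'z \<Rightarrow> 's \<times> 'z" where b: "bij_betw b UNIV (D \<times> UNIV)"
  proof -
    have "inj (\<lambda>z. (d, z) :: 's \<times> 'z)" "range (\<lambda>z. (d, z) :: 's \<times> 'z) \<subseteq> D \<times> UNIV"
      using d by (auto intro: injI)
    moreover have "inj_on j (D \<times> UNIV)" "j ` (D \<times> UNIV) \<subseteq> UNIV"
      using j by (auto intro: inj_on_subset)
    ultimately show ?thesis using Schroeder_Bernstein that by meson
  qed
  have bD: "fst (b z) \<in> D" for z
    using bij_betw_apply[OF b, of z] by (simp add: mem_Times_iff)
  let ?h = "\<lambda>(l, z). (a l (fst (b z)), snd (b z))"
  have "bij_betw ?h (carrier G \<times> UNIV) (S \<times> UNIV)"
  proof (rule bij_betw_imageI)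
    show "inj_on ?h (carrier G \<times> UNIV)"
    proof (rule inj_onI, clarify)
      fix l l' z z'
      assume l: "l \<in> carrier G" "l' \<in> carrier G"
        and eq: "a l (fst (b z)) = a l' (fst (b z'))" and s: "snd (b z) = snd (b z')"
      have "(l, fst (b z)) = (l', fst (b z'))"
        using inj_onD[OF bij_betw_imp_inj_on[OF bij], of "(l, fst (b z))" "(l', fst (b z'))"] l eq bD
        by simp
      moreover from this s have "b z = b z'" by (simp add: prod_eq_iff)
      ultimately show "l = l' \<and> z = z'"
        using bij_betw_imp_inj_on[OF b] by (auto dest: injD)
    qed
    show "?h ` (carrier G \<times> UNIV) = S \<times> UNIV"
    proof
      show "?h ` (carrier G \<times> UNIV) \<subseteq> S \<times> UNIV"
        using bD D a by (auto simp: free_action_def)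
      show "S \<times> UNIV \<subseteq> ?h ` (carrier G \<times> UNIV)"
      proof clarify
        fix x and z :: 'z assume "x \<in> S"
        then obtain l d where l: "l \<in> carrier G" "d \<in> D" "x = a l d"
          using bij_betw_imp_surj_on[OF bij] by force
        then obtain z' where "b z' = (d, z)"
          using bij_betw_imp_surj_on[OF b] by (metis SigmaI UNIV_I imageE)
        then show "(x, z) \<in> ?h ` (carrier G \<times> UNIV)"
          using l by (intro image_eqI[of _ _ "(l, z')"]) auto
      qed
    qed
  qed
  moreover have "?h (l \<otimes> l', z) = map_prod (a l) id (?h (l', z))"
    if "l \<in> carrier G" "l' \<in> carrier G" for l l' z
  proof -
    have "fst (b z) \<in> S" using bD D by blast
    then show ?thesis using that a by (auto simp: free_action_def)
  qed
  ultimately show ?thesis by blast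
qed

section \<open>Permutation groups\<close>

lemma carrier_BijGroup [simp]: "carrier (BijGroup S) = Bij S"
  by (simp add: BijGroup_def)

lemma Bij_apply: "f \<in> Bij S \<Longrightarrow> x \<in> S \<Longrightarrow> f x \<in> S"
  by (auto dest: Bij_imp_funcset)

lemma BijGroup_mult_apply:
  "f \<in> Bij S \<Longrightarrow> g \<in> Bij S \<Longrightarrow> x \<in> S \<Longrightarrow> (f \<otimes>\<^bsub>BijGroup S\<^esub> g) x = f (g x)"
  by (simp add: BijGroup_def compose_def)

lemma BijGroup_one_apply: "x \<in> S \<Longrightarrow> \<one>\<^bsub>BijGroup S\<^esub> x = x"
  by (simp add: BijGroup_def)

lemma Bij_eqI: "f \<in> Bij S \<Longrightarrow> g \<in> Bij S \<Longrightarrow> (\<And>x. x \<in> S \<Longrightarrow> f x = g x) \<Longrightarrow> f = g"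
  by (auto simp: Bij_def intro: extensionalityI)

lemma inv_BijGroup_apply:
  assumes "f \<in> Bij S" "x \<in> S" "y \<in> S" "f y = x" shows "(inv\<^bsub>BijGroup S\<^esub> f) x = y"
  using assms by (auto simp: inv_BijGroup Bij_def bij_betw_def)

text \<open>A bijection from \<open>Y\<close> to its complement, used in both directions, is an involution; this makes
conjugation by \<open>\<tau>\<close> symmetric and spares the inverses in the ping-pong argument.\<close>

lemma swap_involution:
  assumes \<eta>: "bij_betw \<eta> Y (S - Y)" and "Y \<subseteq> S"
  defines "\<tau> \<equiv> \<lambda>x\<in>S. if x \<in> Y then \<eta> x else inv_into Y \<eta> x"
  shows "\<tau> \<in> Bij S" "\<And>x. x \<in> S \<Longrightarrow> \<tau> (\<tau> x) = x" "\<And>x. x \<in> S \<Longrightarrow> \<tau> x \<in> Y \<longleftrightarrow> x \<notin> Y"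
proof -
  have 1: "\<eta> x \<in> S - Y" "inv_into Y \<eta> (\<eta> x) = x" if "x \<in> Y" for x
    using \<eta> that by (auto simp: bij_betw_def)
  have 2: "inv_into Y \<eta> x \<in> Y" "\<eta> (inv_into Y \<eta> x) = x" if "x \<in> S - Y" for x
    using \<eta> that by (auto simp: bij_betw_def inv_into_into f_inv_into_f)
  have closed: "\<tau> x \<in> S" if "x \<in> S" for x
    using that 1 2 assms(2) by (auto simp: \<tau>_def)
  show "\<tau> x \<in> Y \<longleftrightarrow> x \<notin> Y" if "x \<in> S" for x using that 1 2 by (auto simp: \<tau>_def)
  show inv: "\<tau> (\<tau> x) = x" if "x \<in> S" for x
    using that 1[of x] 2[of x] assms(2) by (cases "x \<in> Y") (auto simp: \<tau>_def)
  have "bij_betw \<tau> S S" using closed inv by (intro bij_betwI[of _ _ _ \<tau>]) auto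
  then show "\<tau> \<in> Bij S" by (simp add: Bij_def \<tau>_def)
qed

text \<open>The left regular action on a union \<open>G \<times> W\<close> of copies of \<open>G\<close>, transported to \<open>S\<close> along \<open>\<theta>\<close>.\<close>

lemma (in group) translation_action_hom:
  assumes \<theta>: "bij_betw \<theta> S (carrier G \<times> W)"
  shows "(\<lambda>k. \<lambda>x\<in>S. inv_into S \<theta> (map_prod ((\<otimes>) k) id (\<theta> x))) \<in> hom G (BijGroup S)"
proof -
  let ?\<rho> = "\<lambda>k. \<lambda>x\<in>S. inv_into S \<theta> (map_prod ((\<otimes>) k) id (\<theta> x))"
  have im: "\<theta> x \<in> carrier G \<times> W" if "x \<in> S" for x using \<theta> that by (auto simp: bij_betw_def)
  have inv: "inv_into S \<theta> y \<in> S" "\<theta> (inv_into S \<theta> y) = y" if "y \<in> carrier G \<times> W" for y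
    using \<theta> that by (auto simp: bij_betw_def inv_into_into f_inv_into_f)
  have inv': "inv_into S \<theta> (\<theta> x) = x" if "x \<in> S" for x
    using \<theta> that by (auto simp: bij_betw_def)
  have tr: "map_prod ((\<otimes>) k) id y \<in> carrier G \<times> W" if "k \<in> carrier G" "y \<in> carrier G \<times> W" for k y
    using that by auto
  have closed: "?\<rho> k x \<in> S" if "k \<in> carrier G" "x \<in> S" for k x
    using that inv(1) tr im by simp
  have mult: "?\<rho> (k \<otimes> l) x = ?\<rho> k (?\<rho> l x)" if "k \<in> carrier G" "l \<in> carrier G" "x \<in> S" for k l x
  proof -
    have "map_prod ((\<otimes>) (k \<otimes> l)) id (\<theta> x) = map_prod ((\<otimes>) k) id (map_prod ((\<otimes>) l) id (\<theta> x))"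
      using im[OF that(3)] that by (auto simp: m_assoc)
    then show ?thesis using that closed inv(2) tr im by simp
  qed
  have one: "?\<rho> \<one> x = x" if "x \<in> S" for x
  proof -
    have "map_prod ((\<otimes>) \<one>) id (\<theta> x) = \<theta> x" using im[OF that] by auto
    then show ?thesis using inv' that by simp
  qed
  have bij: "?\<rho> k \<in> Bij S" if "k \<in> carrier G" for k
  proof -
    have "bij_betw (?\<rho> k) S S"
      using closed that mult[of k "inv k"] mult[of "inv k" k] one
      by (intro bij_betwI[of _ _ _ "?\<rho> (inv k)"]) auto
    then show ?thesis by (simp add: Bij_def)
  qed
  have "?\<rho> (k \<otimes> l) = ?\<rho> k \<otimes>\<^bsub>BijGroup S\<^esub> ?\<rho> l" if "k \<in> carrier G" "l \<in> carrier G" for k l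
  proof -
    have kl: "k \<otimes> l \<in> carrier G" using that by simp
    have "?\<rho> k \<otimes>\<^bsub>BijGroup S\<^esub> ?\<rho> l \<in> Bij S"
      using group.is_monoid[OF group_BijGroup, of S, THEN monoid.m_closed] bij that by simp
    then show ?thesis
      using mult that bij kl BijGroup_mult_apply[OF bij[OF that(1)] bij[OF that(2)]]
      by (intro Bij_eqI[of _ S]) (simp_all del: restrict_apply)
  qed
  then show ?thesis using bij by (intro homI) auto
qed

section \<open>Reduced words\<close>

abbreviation syllables :: "'x list \<Rightarrow> 'x word"
  where "syllables w \<equiv> map (\<lambda>p. (p, True)) w"

definition reduced_words :: "('a, 'm) monoid_scheme \<Rightarrow> 'i set \<Rightarrow> ('i \<Rightarrow> 'a set) \<Rightarrow> ('i \<times> 'a) list set"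
  where "reduced_words G I A =
    {w. set w \<subseteq> (SIGMA i:I. A i - {\<one>\<^bsub>G\<^esub>}) \<and> distinct_adj (map fst w)}"

text \<open>The working form of freeness; it is equivalent to \<^const>\<open>join_is_free_product\<close> for subgroups of a group
(\<open>join_is_free_productI\<close> and \<open>join_is_free_productD\<close> below).\<close>

definition reduced_words_nontrivial :: "('a, 'm) monoid_scheme \<Rightarrow> 'i set \<Rightarrow> ('i \<Rightarrow> 'a set) \<Rightarrow> bool"
  where "reduced_words_nontrivial G I A \<longleftrightarrow>
    (\<forall>w\<in>reduced_words G I A. word_eval G snd (syllables w) = \<one>\<^bsub>G\<^esub> \<longrightarrow> w = [])"

lemma words_syllables [simp]: "syllables w \<in> words X \<longleftrightarrow> set w \<subseteq> X"
  by (induction w) auto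

lemma reduced_words_Cons:
  "p # w \<in> reduced_words G I A \<longleftrightarrow> p \<in> (SIGMA i:I. A i - {\<one>\<^bsub>G\<^esub>}) \<and> w \<in> reduced_words G I A \<and>
    (w \<noteq> [] \<longrightarrow> fst p \<noteq> fst (hd w))"
  by (auto simp: reduced_words_def distinct_adj_Cons hd_map)

lemma reduced_words_append:
  "u @ v \<in> reduced_words G I A \<longleftrightarrow> u \<in> reduced_words G I A \<and> v \<in> reduced_words G I A \<and>
    (u \<noteq> [] \<longrightarrow> v \<noteq> [] \<longrightarrow> fst (last u) \<noteq> fst (hd v))"
  by (auto simp: reduced_words_def distinct_adj_append_iff hd_map last_map)

section \<open>The ping-pong argument\<close>

text \<open>The permutation \<open>\<tau> i\<close> is the image of the stable letter \<open>t i\<close>, and commuting with \<open>A i\<close> is its defining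
relation. The base point \<open>x\<^sub>0\<close> detects nontrivial elements of \<open>G\<close>, as its stabilizer is trivial, and it
detects all other nontrivial words because its orbit avoids the ping-pong tables \<open>Y i\<close>.\<close>

locale ping_pong = group G for G :: "('a, 'm) monoid_scheme" (structure) +
  fixes I :: "'i set" and A :: "'i \<Rightarrow> 'a set" and \<Omega> :: "'s set"
    and \<rho> :: "'a \<Rightarrow> 's \<Rightarrow> 's" and \<tau> :: "'i \<Rightarrow> 's \<Rightarrow> 's" and Y :: "'i \<Rightarrow> 's set" and x\<^sub>0 :: 's
  assumes subgroup_A: "i \<in> I \<Longrightarrow> subgroup (A i) G"
    and \<rho>_hom: "\<rho> \<in> hom G (BijGroup \<Omega>)"
    and \<tau>_Bij: "i \<in> I \<Longrightarrow> \<tau> i \<in> Bij \<Omega>"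
    and \<tau>_involution: "i \<in> I \<Longrightarrow> x \<in> \<Omega> \<Longrightarrow> \<tau> i (\<tau> i x) = x"
    and \<tau>_commute: "i \<in> I \<Longrightarrow> a \<in> A i \<Longrightarrow> x \<in> \<Omega> \<Longrightarrow> \<tau> i (\<rho> a x) = \<rho> a (\<tau> i x)"
    and \<tau>_swap: "i \<in> I \<Longrightarrow> x \<in> \<Omega> \<Longrightarrow> \<tau> i x \<in> Y i \<longleftrightarrow> x \<notin> Y i"
    and Y_subset: "i \<in> I \<Longrightarrow> Y i \<subseteq> \<Omega>"
    and Y_moved: "i \<in> I \<Longrightarrow> g \<in> carrier G - A i \<Longrightarrow> x \<in> Y i \<Longrightarrow> \<rho> g x \<notin> Y i"
    and Y_separated: "i \<in> I \<Longrightarrow> j \<in> I \<Longrightarrow> i \<noteq> j \<Longrightarrow> g \<in> carrier G \<Longrightarrow> x \<in> Y i \<Longrightarrow> \<rho> g x \<notin> Y j"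
    and x\<^sub>0: "x\<^sub>0 \<in> \<Omega>" and x\<^sub>0_free: "g \<in> carrier G \<Longrightarrow> \<rho> g x\<^sub>0 = x\<^sub>0 \<Longrightarrow> g = \<one>"
    and x\<^sub>0_notin: "i \<in> I \<Longrightarrow> g \<in> carrier G \<Longrightarrow> \<rho> g x\<^sub>0 \<notin> Y i"
begin

text \<open>The image of \<open>g\<^sup>t\<close> for \<open>t = t i\<close>; letters \<open>(i, g)\<close> stand for these conjugates.\<close>

definition conj_action :: "'i \<times> 'a \<Rightarrow> 's \<Rightarrow> 's"
  where "conj_action = (\<lambda>(i, g). inv\<^bsub>BijGroup \<Omega>\<^esub> \<tau> i \<otimes>\<^bsub>BijGroup \<Omega>\<^esub> \<rho> g \<otimes>\<^bsub>BijGroup \<Omega>\<^esub> \<tau> i)"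

sublocale \<Omega>: group "BijGroup \<Omega>" by (rule group_BijGroup)

lemma \<rho>_Bij: "g \<in> carrier G \<Longrightarrow> \<rho> g \<in> Bij \<Omega>"
  using hom_in_carrier[OF \<rho>_hom] by simp

lemma \<rho>_mult: "g \<in> carrier G \<Longrightarrow> h \<in> carrier G \<Longrightarrow> x \<in> \<Omega> \<Longrightarrow> \<rho> (g \<otimes> h) x = \<rho> g (\<rho> h x)"
  using hom_mult[OF \<rho>_hom, of g h] by (simp add: BijGroup_mult_apply \<rho>_Bij)

lemma \<rho>_one: "x \<in> \<Omega> \<Longrightarrow> \<rho> \<one> x = x"
  using hom_one[OF \<rho>_hom is_group \<Omega>.is_group] by (simp add: BijGroup_one_apply)

lemma \<rho>_inv: "g \<in> carrier G \<Longrightarrow> x \<in> \<Omega> \<Longrightarrow> \<rho> (inv g) (\<rho> g x) = x"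
  using \<rho>_mult[of "inv g" g x] \<rho>_one by simp

lemma conj_action_Bij: "i \<in> I \<Longrightarrow> g \<in> carrier G \<Longrightarrow> conj_action (i, g) \<in> Bij \<Omega>"
  using \<Omega>.m_closed \<Omega>.inv_closed \<tau>_Bij \<rho>_Bij by (simp add: conj_action_def)

lemma conj_action_apply:
  assumes "i \<in> I" "g \<in> carrier G" "x \<in> \<Omega>"
  shows "conj_action (i, g) x = \<tau> i (\<rho> g (\<tau> i x))"
proof -
  have m: "\<tau> i x \<in> \<Omega>" "\<rho> g (\<tau> i x) \<in> \<Omega>" using assms \<tau>_Bij \<rho>_Bij by (auto intro: Bij_apply)
  have "inv\<^bsub>BijGroup \<Omega>\<^esub> \<tau> i \<in> Bij \<Omega>" using \<Omega>.inv_closed \<tau>_Bij assms by simp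
  moreover from this have "inv\<^bsub>BijGroup \<Omega>\<^esub> \<tau> i \<otimes>\<^bsub>BijGroup \<Omega>\<^esub> \<rho> g \<in> Bij \<Omega>"
    using \<Omega>.m_closed \<rho>_Bij assms by simp
  moreover have "(inv\<^bsub>BijGroup \<Omega>\<^esub> \<tau> i) y = \<tau> i y" if "y \<in> \<Omega>" for y
    using that assms \<tau>_Bij \<tau>_involution by (intro inv_BijGroup_apply) (auto intro: Bij_apply)
  ultimately show ?thesis
    using assms m \<tau>_Bij \<rho>_Bij by (simp add: conj_action_def BijGroup_mult_apply)
qed

lemma conj_action_base:
  assumes "i \<in> I" "a \<in> A i" "x \<in> \<Omega>" shows "conj_action (i, a) x = \<rho> a x"
proof -
  have "a \<in> carrier G" using assms subgroup.mem_carrier[OF subgroup_A] by blast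
  then show ?thesis using assms \<tau>_Bij
    by (simp add: conj_action_apply \<tau>_commute \<tau>_involution Bij_apply)
qed

lemma conj_action_into:
  assumes "i \<in> I" "g \<in> carrier G - A i" "x \<in> \<Omega>" "x \<notin> Y i"
  shows "conj_action (i, g) x \<in> Y i"
proof -
  have "\<tau> i x \<in> Y i" using assms \<tau>_swap by simp
  then have "\<rho> g (\<tau> i x) \<notin> Y i" using assms Y_moved by simp
  moreover have "\<rho> g (\<tau> i x) \<in> \<Omega>" using assms \<tau>_Bij \<rho>_Bij by (auto intro: Bij_apply)
  ultimately show ?thesis using assms \<tau>_swap by (simp add: conj_action_apply)
qed

abbreviation conj_eval :: "('i \<times> 'a) list \<Rightarrow> 's \<Rightarrow> 's"
  where "conj_eval w \<equiv> word_eval (BijGroup \<Omega>) conj_action (syllables w)"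

lemma conj_eval_Bij:
  assumes "set w \<subseteq> I \<times> carrier G" shows "conj_eval w \<in> Bij \<Omega>"
  using \<Omega>.word_eval_closed[of conj_action "I \<times> carrier G" "syllables w"] assms conj_action_Bij by auto

lemma conj_eval_append:
  assumes "set u \<subseteq> I \<times> carrier G" "set v \<subseteq> I \<times> carrier G" "x \<in> \<Omega>"
  shows "conj_eval (u @ v) x = conj_eval u (conj_eval v x)"
proof -
  have "conj_action \<in> I \<times> carrier G \<rightarrow> carrier (BijGroup \<Omega>)" using conj_action_Bij by auto
  then have "conj_eval (u @ v) = conj_eval u \<otimes>\<^bsub>BijGroup \<Omega>\<^esub> conj_eval v"
    using \<Omega>.word_eval_append[of conj_action "I \<times> carrier G"] assms by simp
  then show ?thesis using assms conj_eval_Bij by (simp add: BijGroup_mult_apply)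
qed

lemma conj_eval_Cons:
  assumes "i \<in> I" "g \<in> carrier G" "set v \<subseteq> I \<times> carrier G" "x \<in> \<Omega>"
  shows "conj_eval ((i, g) # v) x = conj_action (i, g) (conj_eval v x)"
  using assms conj_action_Bij conj_eval_Bij by (simp add: BijGroup_mult_apply)

lemma conj_eval_base:
  assumes "set v \<subseteq> Sigma I A" "x \<in> \<Omega>"
  shows "word_eval G snd (syllables v) \<in> carrier G"
    "conj_eval v x = \<rho> (word_eval G snd (syllables v)) x"
proof -
  have A: "A i \<subseteq> carrier G" if "i \<in> I" for i using subgroup.subset[OF subgroup_A[OF that]] .
  have c: "word_eval G snd (syllables u) \<in> carrier G" if "set u \<subseteq> Sigma I A" for u
    using word_eval_closed[of snd "Sigma I A" "syllables u"] that A by (auto simp: Pi_iff)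
  show "word_eval G snd (syllables v) \<in> carrier G" using c assms by simp
  show "conj_eval v x = \<rho> (word_eval G snd (syllables v)) x"
    using assms(1)
  proof (induction v)
    case Nil
    then show ?case using \<rho>_one assms by (simp add: BijGroup_one_apply)
  next
    case (Cons p v)
    obtain i a where p: "p = (i, a)" by (cases p)
    have m: "i \<in> I" "a \<in> A i" "set v \<subseteq> Sigma I A" "a \<in> carrier G" using Cons.prems p A by auto
    then have "set v \<subseteq> I \<times> carrier G" using A by blast
    then have "conj_eval (p # v) x = conj_action (i, a) (conj_eval v x)"
      unfolding p using m assms by (intro conj_eval_Cons)
    also have "\<dots> = \<rho> a (\<rho> (word_eval G snd (syllables v)) x)"
      using Cons.IH[OF m(3)] c[OF m(3)] \<rho>_Bij assms m by (simp add: conj_action_base Bij_apply)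
    also have "\<dots> = \<rho> (word_eval G snd (syllables (p # v))) x"
      using c[OF m(3)] m assms \<rho>_mult p by simp
    finally show ?case .
  qed
qed

text \<open>Syllables from the \<open>A i\<close> are unaffected by the conjugation, so they are split off as the longest
prefix \<open>v\<close> that consists of them; the next syllable \<open>(k, g)\<close> moves the base point into \<open>Y k\<close>.\<close>

lemma reduced_words_cases:
  assumes "w \<in> reduced_words G I (\<lambda>_. carrier G)"
  obtains "w \<in> reduced_words G I A"
  | v k g u where "w = v @ (k, g) # u" "v \<in> reduced_words G I A" "k \<in> I" "g \<in> carrier G - A k"
proof -
  let ?P = "\<lambda>(i, g). g \<in> A i"
  have w: "set w \<subseteq> I \<times> (carrier G - {\<one>})" using assms by (auto simp: reduced_words_def)
  have t: "takeWhile ?P w \<in> reduced_words G I A"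
  proof -
    have "takeWhile ?P w \<in> reduced_words G I (\<lambda>_. carrier G)"
      using assms reduced_words_append[of "takeWhile ?P w" "dropWhile ?P w" G I "\<lambda>_. carrier G"]
      by simp
    moreover have "p \<in> set w \<and> ?P p" if "p \<in> set (takeWhile ?P w)" for p
      using that by (auto dest: set_takeWhileD)
    ultimately show ?thesis using w by (fastforce simp: reduced_words_def)
  qed
  show thesis
  proof (cases "dropWhile ?P w")
    case Nil
    then have "takeWhile ?P w = w" by (metis append_Nil2 takeWhile_dropWhile_id)
    then have "w \<in> reduced_words G I A" using t by metis
    then show thesis by (rule that(1))
  next
    case (Cons p u)
    obtain k g where p: "p = (k, g)" by (cases p)
    have weq: "w = takeWhile ?P w @ p # u" using Cons by (metis takeWhile_dropWhile_id)
    then have "p \<in> set w" by (metis in_set_conv_decomp)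
    moreover have "\<not> ?P p" using Cons by (metis hd_dropWhile list.discI list.sel(1))
    ultimately show thesis using that(2)[OF _ t, of k g u] weq w p by auto
  qed
qed

lemma reduced_words_carrier:
  "w \<in> reduced_words G I (\<lambda>_. carrier G) \<Longrightarrow> set w \<subseteq> I \<times> carrier G"
  by (auto simp: reduced_words_def)

lemma reduced_words_A:
  "w \<in> reduced_words G I A \<Longrightarrow> set w \<subseteq> Sigma I A \<and> set w \<subseteq> I \<times> carrier G"
  using subgroup.subset[OF subgroup_A] by (fastforce simp: reduced_words_def)

text \<open>If the product were \<open>a \<in> A i\<close>, then prefixing the word with \<open>(i, a\<inverse>)\<close> would give a reduced word with
trivial product. The same word \<open>v\<close> already excludes \<open>a = \<one>\<close>.\<close>

lemma reduced_product_notin: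
  assumes red: "reduced_words_nontrivial G I A"
    and v: "v \<in> reduced_words G I A" "v \<noteq> []" "fst (hd v) \<noteq> i" and "i \<in> I"
  shows "word_eval G snd (syllables v) \<notin> A i"
proof
  let ?a = "word_eval G snd (syllables v)"
  assume a: "?a \<in> A i"
  interpret Ai: subgroup "A i" G using subgroup_A \<open>i \<in> I\<close> .
  have "?a \<noteq> \<one>" using red v by (auto simp: reduced_words_nontrivial_def)
  then have "(i, inv ?a) # v \<in> reduced_words G I A"
    using a v \<open>i \<in> I\<close> Ai.mem_carrier by (auto simp: reduced_words_Cons inv_eq_1_iff)
  moreover have "word_eval G snd (syllables ((i, inv ?a) # v)) = \<one>"
    using a Ai.mem_carrier by simp
  ultimately show False using red by (auto simp: reduced_words_nontrivial_def)
qed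

lemma conj_eval_split:
  assumes w: "w \<in> reduced_words G I (\<lambda>_. carrier G)" "w = v @ (k, g) # u"
    and v: "v \<in> reduced_words G I A" and k: "k \<in> I" "g \<in> carrier G - A k"
    and "conj_eval u x\<^sub>0 \<notin> Y k"
  obtains y where "y \<in> Y k" "conj_eval w x\<^sub>0 = \<rho> (word_eval G snd (syllables v)) y"
    "word_eval G snd (syllables v) \<in> carrier G"
proof -
  let ?y = "conj_action (k, g) (conj_eval u x\<^sub>0)"
  have u: "set u \<subseteq> I \<times> carrier G" using reduced_words_carrier[OF w(1)] w(2) by simp
  have v': "set v \<subseteq> Sigma I A" "set v \<subseteq> I \<times> carrier G" using reduced_words_A v by auto
  have "conj_eval u x\<^sub>0 \<in> \<Omega>" using conj_eval_Bij u x\<^sub>0 by (auto intro: Bij_apply)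
  then have y: "?y \<in> Y k" using conj_action_into assms by simp
  then have "?y \<in> \<Omega>" using Y_subset k by blast
  have "conj_eval w x\<^sub>0 = conj_eval v ?y"
    using conj_eval_append[of v "(k, g) # u" x\<^sub>0] conj_eval_Cons[of k g u x\<^sub>0] u v' k w(2) x\<^sub>0
    by simp
  then show thesis using that[OF y] conj_eval_base[OF v'(1) \<open>?y \<in> \<Omega>\<close>] by simp
qed

text \<open>The ping-pong invariant: only a word that starts with index \<open>i\<close> can move \<open>x\<^sub>0\<close> into \<open>Y i\<close>. After
removing the prefix of syllables from the \<open>A j\<close>, the induction hypothesis for the rest \<open>u\<close> puts the image of
\<open>x\<^sub>0\<close> under \<open>(k, g) # u\<close> into \<open>Y k\<close>. The prefix acts by an element \<open>b\<close> of \<open>G\<close>, which moves \<open>Y k\<close> off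
\<open>Y i\<close>: for \<open>i \<noteq> k\<close> because the translates are disjoint, and for \<open>i = k\<close> because \<open>b\<close> is not
in \<open>A i\<close>.\<close>

lemma conj_eval_notin:
  assumes red: "reduced_words_nontrivial G I A"
  shows "w \<in> reduced_words G I (\<lambda>_. carrier G) \<Longrightarrow> i \<in> I \<Longrightarrow> (w \<noteq> [] \<longrightarrow> fst (hd w) \<noteq> i) \<Longrightarrow>
    conj_eval w x\<^sub>0 \<notin> Y i"
proof (induction "length w" arbitrary: w i rule: less_induct)
  case less
  show ?case
  proof (cases rule: reduced_words_cases[OF less.prems(1)])
    case 1
    then show ?thesis
      using conj_eval_base[OF _ x\<^sub>0] reduced_words_A x\<^sub>0_notin less.prems by simp
  next
    case (2 v k g u)
    let ?j = "word_eval G snd (syllables v)"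
    have "u \<in> reduced_words G I (\<lambda>_. carrier G)" "u \<noteq> [] \<longrightarrow> fst (hd u) \<noteq> k"
      using less.prems(1) 2(1) by (auto simp: reduced_words_append reduced_words_Cons)
    then have "conj_eval u x\<^sub>0 \<notin> Y k" using less.hyps[of u k] 2 by simp
    then obtain y where y: "y \<in> Y k" "conj_eval w x\<^sub>0 = \<rho> ?j y" and j: "?j \<in> carrier G"
      using conj_eval_split[OF less.prems(1) 2] by blast
    show ?thesis
    proof (cases "i = k")
      case False
      then show ?thesis using Y_separated[of k i ?j y] 2 less.prems j y by simp
    next
      case True
      then have "v \<noteq> []" "fst (hd v) \<noteq> i" using less.prems(3) 2(1) by (cases v; auto)+
      then have "?j \<notin> A i" using reduced_product_notin[OF red] 2 less.prems by simp
      then show ?thesis using Y_moved[of i ?j y] less.prems j y True by simp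
    qed
  qed
qed

text \<open>A word in the \<open>A i\<close> acts by its product, which is nontrivial by assumption. Any other word puts
\<open>x\<^sub>0\<close> into a translate of some \<open>Y k\<close>, where the orbit of \<open>x\<^sub>0\<close> has no point.\<close>

lemma conj_eval_nontrivial:
  assumes red: "reduced_words_nontrivial G I A"
    and w: "w \<in> reduced_words G I (\<lambda>_. carrier G)" "w \<noteq> []"
  shows "conj_eval w x\<^sub>0 \<noteq> x\<^sub>0"
proof (cases rule: reduced_words_cases[OF w(1)])
  case 1
  have "word_eval G snd (syllables w) \<noteq> \<one>"
    using red 1 w by (auto simp: reduced_words_nontrivial_def)
  then show ?thesis
    using conj_eval_base[OF _ x\<^sub>0] reduced_words_A[OF 1] x\<^sub>0_free by auto
next
  case (2 v k g u)
  let ?j = "word_eval G snd (syllables v)"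
  have "u \<in> reduced_words G I (\<lambda>_. carrier G)" "u \<noteq> [] \<longrightarrow> fst (hd u) \<noteq> k"
    using w(1) 2(1) by (auto simp: reduced_words_append reduced_words_Cons)
  then have "conj_eval u x\<^sub>0 \<notin> Y k" using conj_eval_notin[OF red] 2 by simp
  then obtain y where y: "y \<in> Y k" "conj_eval w x\<^sub>0 = \<rho> ?j y" and j: "?j \<in> carrier G"
    using conj_eval_split[OF w(1) 2] by blast
  show ?thesis
  proof
    assume "conj_eval w x\<^sub>0 = x\<^sub>0"
    moreover have "y \<in> \<Omega>" using Y_subset y 2 by blast
    ultimately have "\<rho> (inv ?j) x\<^sub>0 = y" using \<rho>_inv[OF j] y by metis
    then show False using x\<^sub>0_notin[of k "inv ?j"] 2 j y by simp
  qed
qed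

end

section \<open>Existence of ping-pong actions\<close>

lemma group_leD:
  assumes "group_le H G"
  shows "group H" "group G" "carrier H \<subseteq> carrier G"
    "\<And>x y. x \<in> carrier H \<Longrightarrow> y \<in> carrier H \<Longrightarrow> x \<otimes>\<^bsub>H\<^esub> y = x \<otimes>\<^bsub>G\<^esub> y"
  using assms by (auto simp: group_le_def)

lemma group_le_one:
  assumes "group_le H G" shows "\<one>\<^bsub>H\<^esub> = \<one>\<^bsub>G\<^esub>"
proof -
  interpret H: group H by (rule group_leD[OF assms])
  interpret G: group G by (rule group_leD[OF assms])
  have "\<one>\<^bsub>H\<^esub> \<otimes>\<^bsub>G\<^esub> \<one>\<^bsub>H\<^esub> = \<one>\<^bsub>H\<^esub>" using group_leD(4)[OF assms] by (metis H.one_closed H.l_one)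
  then show ?thesis using group_leD(3)[OF assms] by (metis G.l_cancel_one' H.one_closed subsetD)
qed

lemma group_le_inv:
  assumes "group_le H G" "x \<in> carrier H" shows "inv\<^bsub>H\<^esub> x = inv\<^bsub>G\<^esub> x"
proof -
  interpret H: group H by (rule group_leD[OF assms(1)])
  interpret G: group G by (rule group_leD[OF assms(1)])
  have "inv\<^bsub>H\<^esub> x \<otimes>\<^bsub>G\<^esub> x = \<one>\<^bsub>G\<^esub>"
    using group_leD(4)[OF assms(1)] group_le_one[OF assms(1)] assms(2) by (metis H.inv_closed H.l_inv)
  then show ?thesis using group_leD(3)[OF assms(1)] assms(2) by (metis G.inv_equality H.inv_closed subsetD)
qed

lemma group_le_trans: "group_le G M \<Longrightarrow> group_le M K \<Longrightarrow> group_le G K"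
  unfolding group_le_def by (auto simp: subset_iff)

lemma group_le_hom:
  assumes "group_le H G" "f \<in> hom G X" shows "f \<in> hom H X"
  using group_leD[OF assms(1)] assms(2) by (auto simp: hom_def Pi_iff subset_iff)

lemma group_le_subgroup_Int:
  assumes le: "group_le H G" and L: "subgroup L G" shows "subgroup (carrier H \<inter> L) H"
proof -
  interpret H: group H by (rule group_leD[OF le])
  interpret L: subgroup L G by fact
  show ?thesis
  proof (rule H.subgroupI)
    show "carrier H \<inter> L \<noteq> {}" using group_le_one[OF le] L.one_closed H.one_closed by auto
    show "inv\<^bsub>H\<^esub> a \<in> carrier H \<inter> L" if "a \<in> carrier H \<inter> L" for a
      using that group_le_inv[OF le, of a] L.m_inv_closed[of a] H.inv_closed[of a] by simp
    show "a \<otimes>\<^bsub>H\<^esub> b \<in> carrier H \<inter> L" if "a \<in> carrier H \<inter> L" "b \<in> carrier H \<inter> L" for a b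
      using that group_leD(4)[OF le, of a b] L.m_closed[of a b] H.m_closed[of a b] by simp
  qed auto
qed

text \<open>The construction for one index. \<open>\<Omega>\<close> consists of \<open>'s\<close> many sheets, each a copy of the free \<open>M\<close>-set
\<open>M \<times> Z\<close>, where \<open>Z\<close> is the type \<open>'z\<close>. The \<open>M\<close>-isomorphism \<open>h\<close> onto \<open>K \<times> Z\<close>, applied sheet by
sheet, extends the action to \<open>K\<close> and
preserves the sheets. In the coordinates \<open>\<theta>\<close> so obtained, \<open>Y\<close> is the part \<open>L \<times> Z\<close> of sheet \<open>s\<close>. This set is
\<open>L\<close>-invariant, and elements of \<open>K\<close> outside \<open>L\<close> move it to other left cosets of \<open>L\<close>. Its complement has the
form \<open>S \<times> Z\<close> for a free \<open>L\<close>-set \<open>S\<close>, so that both halves are isomorphic to \<open>L \<times> Z\<close>. The second sheet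
\<open>s\<^sub>0\<close> makes sure that \<open>S\<close> is nonempty also for \<open>L = K\<close>.\<close>

lemma sheet_extension:
  fixes M K :: "'a monoid" and s s\<^sub>0 :: 's and j :: "('a \<times> 's) \<times> 'z \<Rightarrow> 'z"
  assumes le: "group_le M K" and L: "subgroup L K" and "s \<noteq> s\<^sub>0" and j: "inj j"
  defines "\<Omega> \<equiv> carrier M \<times> (UNIV :: ('s \<times> 'z) set)"
  shows "\<exists>\<rho> \<tau> Y. \<rho> \<in> hom K (BijGroup \<Omega>) \<and> \<tau> \<in> Bij \<Omega> \<and> Y \<subseteq> \<Omega> \<and>
    (\<forall>m\<in>carrier M. \<forall>x\<in>\<Omega>. \<rho> m x = map_prod ((\<otimes>\<^bsub>M\<^esub>) m) id x) \<and>
    (\<forall>x\<in>\<Omega>. \<tau> (\<tau> x) = x) \<and>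
    (\<forall>l\<in>L. \<forall>x\<in>\<Omega>. \<tau> (\<rho> l x) = \<rho> l (\<tau> x)) \<and>
    (\<forall>x\<in>\<Omega>. \<tau> x \<in> Y \<longleftrightarrow> x \<notin> Y) \<and>
    (\<forall>k\<in>carrier K - L. \<forall>x\<in>Y. \<rho> k x \<notin> Y) \<and>
    (\<forall>x\<in>Y. fst (snd x) = s)"
proof -
  interpret M: group M by (rule group_leD[OF le])
  interpret K: group K by (rule group_leD[OF le])
  interpret L: subgroup L K by fact
  have free: "free_action M (carrier K) ((\<otimes>\<^bsub>K\<^esub>))"
    using group_leD(3,4)[OF le] group_le_one[OF le]
    by (auto simp: free_action_def K.m_assoc subset_iff)
  have inj: "inj (\<lambda>(k, z). j ((k, s\<^sub>0), z))" using j by (auto intro!: injI dest!: injD)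
  obtain h :: "'a \<times> 'z \<Rightarrow> 'a \<times> 'z" where h: "bij_betw h (carrier M \<times> UNIV) (carrier K \<times> UNIV)"
      and h_mult: "\<And>m m' z. m \<in> carrier M \<Longrightarrow> m' \<in> carrier M \<Longrightarrow>
        h (m \<otimes>\<^bsub>M\<^esub> m', z) = map_prod ((\<otimes>\<^bsub>K\<^esub>) m) id (h (m', z))"
    using M.free_action_trivialization[OF free K.carrier_not_empty inj] by blast
  define \<theta> :: "'a \<times> 's \<times> 'z \<Rightarrow> 'a \<times> 's \<times> 'z"
    where "\<theta> = (\<lambda>(m, t, z). (fst (h (m, z)), t, snd (h (m, z))))"
  have \<theta>: "bij_betw \<theta> \<Omega> (carrier K \<times> UNIV)"
  proof (rule bij_betw_imageI)
    show "inj_on \<theta> \<Omega>"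
    proof (rule inj_onI)
      fix x y assume "x \<in> \<Omega>" "y \<in> \<Omega>" and eq: "\<theta> x = \<theta> y"
      then obtain m t z m' t' z' where xy: "x = (m, t, z)" "y = (m', t', z')"
          and m: "m \<in> carrier M" "m' \<in> carrier M"
        by (auto simp: \<Omega>_def)
      have "(fst (h (m, z)), t, snd (h (m, z))) = (fst (h (m', z')), t', snd (h (m', z')))"
        using eq unfolding xy \<theta>_def by simp
      then have "h (m, z) = h (m', z')" "t = t'" by (auto intro: prod_eqI)
      then show "x = y"
        using inj_onD[OF bij_betw_imp_inj_on[OF h], of "(m, z)" "(m', z')"] xy m by simp
    qed
    show "\<theta> ` \<Omega> = carrier K \<times> UNIV"
    proof
      show "\<theta> ` \<Omega> \<subseteq> carrier K \<times> UNIV"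
        using bij_betw_apply[OF h] by (auto simp: \<Omega>_def \<theta>_def mem_Times_iff)
      show "carrier K \<times> UNIV \<subseteq> \<theta> ` \<Omega>"
      proof clarify
        fix k t z assume "k \<in> carrier K"
        then obtain m z' where "m \<in> carrier M" "h (m, z') = (k, z)"
          using bij_betw_imp_surj_on[OF h] by (metis (no_types, lifting) UNIV_I imageE mem_Sigma_iff prod.exhaust)
        then show "(k, t, z) \<in> \<theta> ` \<Omega>"
          by (intro image_eqI[of _ _ "(m, t, z')"]) (auto simp: \<theta>_def \<Omega>_def)
      qed
    qed
  qed
  define \<rho> where "\<rho> k = (\<lambda>x\<in>\<Omega>. inv_into \<Omega> \<theta> (map_prod ((\<otimes>\<^bsub>K\<^esub>) k) id (\<theta> x)))" for k
  have \<rho>: "\<rho> \<in> hom K (BijGroup \<Omega>)" using K.translation_action_hom[OF \<theta>] by (simp add: \<rho>_def[abs_def])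
  have \<rho>_closed: "\<rho> k x \<in> \<Omega>" if "k \<in> carrier K" "x \<in> \<Omega>" for k x
    using Bij_apply[of "\<rho> k" \<Omega> x] hom_in_carrier[OF \<rho> that(1)] that by simp
  have \<theta>K: "\<theta> x \<in> carrier K \<times> UNIV" if "x \<in> \<Omega>" for x using bij_betw_apply[OF \<theta> that] .
  have \<theta>\<rho>: "\<theta> (\<rho> k x) = map_prod ((\<otimes>\<^bsub>K\<^esub>) k) id (\<theta> x)" if "k \<in> carrier K" "x \<in> \<Omega>" for k x
  proof -
    have "map_prod ((\<otimes>\<^bsub>K\<^esub>) k) id (\<theta> x) \<in> \<theta> ` \<Omega>"
      using \<theta>K[OF that(2)] that bij_betw_imp_surj_on[OF \<theta>] by auto
    then show ?thesis using that by (simp add: \<rho>_def f_inv_into_f)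
  qed
  have \<theta>_eqD: "x = y" if "\<theta> x = \<theta> y" "x \<in> \<Omega>" "y \<in> \<Omega>" for x y
    using inj_onD[OF bij_betw_imp_inj_on[OF \<theta>]] that by blast
  have \<rho>M: "\<rho> m x = map_prod ((\<otimes>\<^bsub>M\<^esub>) m) id x" if "m \<in> carrier M" "x \<in> \<Omega>" for m x
  proof (rule \<theta>_eqD)
    have m: "m \<in> carrier K" using that group_leD(3)[OF le] by blast
    then show "\<rho> m x \<in> \<Omega>" using that \<rho>_closed by simp
    show "map_prod ((\<otimes>\<^bsub>M\<^esub>) m) id x \<in> \<Omega>" using that by (auto simp: \<Omega>_def)
    show "\<theta> (\<rho> m x) = \<theta> (map_prod ((\<otimes>\<^bsub>M\<^esub>) m) id x)"
      using that m \<theta>\<rho> h_mult by (auto simp: \<theta>_def \<Omega>_def)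
  qed
  define Y where "Y = {x \<in> \<Omega>. fst (\<theta> x) \<in> L \<and> fst (snd (\<theta> x)) = s}"
  define S where "S = carrier K \<times> UNIV - L \<times> {s}"
  have mL: "l \<otimes>\<^bsub>K\<^esub> k \<in> L \<longleftrightarrow> k \<in> L" if "l \<in> L" "k \<in> carrier K" for l k
  proof
    assume "l \<otimes>\<^bsub>K\<^esub> k \<in> L"
    then have "inv\<^bsub>K\<^esub> l \<otimes>\<^bsub>K\<^esub> (l \<otimes>\<^bsub>K\<^esub> k) \<in> L" using that by blast
    then show "k \<in> L" using that by (simp add: K.m_assoc[symmetric])
  qed (use that in blast)
  have mL': "k \<otimes>\<^bsub>K\<^esub> l \<in> L \<longleftrightarrow> k \<in> L" if "l \<in> L" "k \<in> carrier K" for l k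
  proof
    assume "k \<otimes>\<^bsub>K\<^esub> l \<in> L"
    then have "k \<otimes>\<^bsub>K\<^esub> l \<otimes>\<^bsub>K\<^esub> inv\<^bsub>K\<^esub> l \<in> L" using that by blast
    then show "k \<in> L" using that by (simp add: K.m_assoc)
  qed (use that in blast)
  have Y_\<rho>: "\<rho> l x \<in> Y \<longleftrightarrow> x \<in> Y" if "l \<in> L" "x \<in> \<Omega>" for l x
    using that \<theta>\<rho>[of l x] \<rho>_closed[of l x] mL[of l "fst (\<theta> x)"] \<theta>K[of x] by (auto simp: Y_def)
  have free_S: "free_action (K\<lparr>carrier := L\<rparr>) S (\<lambda>l. map_prod ((\<otimes>\<^bsub>K\<^esub>) l) id)"
    using mL by (auto simp: free_action_def S_def K.m_assoc)
  have "(\<one>\<^bsub>K\<^esub>, s\<^sub>0) \<in> S" using \<open>s \<noteq> s\<^sub>0\<close> by (simp add: S_def)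
  then have "S \<noteq> {}" by blast
  have group_L: "group (K\<lparr>carrier := L\<rparr>)" using L.subgroup_is_group[OF K.is_group] .
  have "\<exists>g. bij_betw g (L \<times> (UNIV :: 'z set)) (S \<times> (UNIV :: 'z set)) \<and>
      (\<forall>l\<in>L. \<forall>l'\<in>L. \<forall>z. g (l \<otimes>\<^bsub>K\<^esub> l', z) = map_prod (map_prod ((\<otimes>\<^bsub>K\<^esub>) l) id) id (g (l', z)))"
    using group.free_action_trivialization[OF group_L free_S \<open>S \<noteq> {}\<close> j] by simp
  then obtain g :: "'a \<times> 'z \<Rightarrow> ('a \<times> 's) \<times> 'z"
    where g: "bij_betw g (L \<times> UNIV) (S \<times> UNIV)"
      and "\<forall>l\<in>L. \<forall>l'\<in>L. \<forall>z.
        g (l \<otimes>\<^bsub>K\<^esub> l', z) = map_prod (map_prod ((\<otimes>\<^bsub>K\<^esub>) l) id) id (g (l', z))"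
    by (elim exE conjE) (rule that)
  note g_mult = this(2)[rule_format]
  \<comment> \<open>\<^term>\<open>q \<circ> g \<circ> p\<close> will be the \<^term>\<open>L\<close>-isomorphism from \<^term>\<open>Y\<close> to its complement\<close>
  define p where "p x = (fst (\<theta> x), snd (snd (\<theta> x)))" for x
  define q where "q = (\<lambda>((k, t), z). inv_into \<Omega> \<theta> (k, t, z))"
  have p: "bij_betw p Y (L \<times> UNIV)"
  proof (rule bij_betw_imageI)
    show "inj_on p Y"
    proof (rule inj_onI)
      fix x y assume "x \<in> Y" "y \<in> Y" "p x = p y"
      then have "\<theta> x = \<theta> y" "x \<in> \<Omega>" "y \<in> \<Omega>" by (simp_all add: p_def Y_def prod_eq_iff)
      then show "x = y" by (rule \<theta>_eqD)
    qed
    show "p ` Y = L \<times> UNIV"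
    proof
      show "L \<times> UNIV \<subseteq> p ` Y"
      proof clarify
        fix l and z :: 'z assume "l \<in> L"
        moreover from this obtain x where "x \<in> \<Omega>" "\<theta> x = (l, s, z)"
          using bij_betw_imp_surj_on[OF \<theta>]
          by (metis L.mem_carrier SigmaI UNIV_I imageE)
        ultimately show "(l, z) \<in> p ` Y" by (intro image_eqI[of _ _ x]) (auto simp: p_def Y_def)
      qed
    qed (auto simp: p_def Y_def)
  qed
  have \<theta>q: "q y \<in> \<Omega>" "\<theta> (q y) = (fst (fst y), snd (fst y), snd y)" if "y \<in> S \<times> UNIV" for y
  proof -
    have "(fst (fst y), snd (fst y), snd y) \<in> \<theta> ` \<Omega>"
      using that bij_betw_imp_surj_on[OF \<theta>] by (auto simp: S_def)
    then show "q y \<in> \<Omega>" "\<theta> (q y) = (fst (fst y), snd (fst y), snd y)"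
      by (auto simp: q_def split_beta inv_into_into f_inv_into_f)
  qed
  have q: "bij_betw q (S \<times> UNIV) (\<Omega> - Y)"
  proof (rule bij_betw_imageI)
    show "inj_on q (S \<times> UNIV)"
    proof (rule inj_onI)
      fix y y' assume y: "y \<in> S \<times> UNIV" "y' \<in> S \<times> UNIV" and "q y = q y'"
      then have "(fst (fst y), snd (fst y), snd y) = (fst (fst y'), snd (fst y'), snd y')"
        by (metis \<theta>q(2))
      then show "y = y'" by (simp add: prod_eq_iff)
    qed
    show "q ` (S \<times> UNIV) = \<Omega> - Y"
    proof
      show "q ` (S \<times> UNIV) \<subseteq> \<Omega> - Y"
      proof (rule image_subsetI)
        fix y assume y: "y \<in> S \<times> (UNIV :: 'z set)"
        then have "fst y \<notin> L \<times> {s}" by (simp add: mem_Times_iff S_def)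
        then have "q y \<notin> Y" using \<theta>q(2)[OF y] by (simp add: mem_Times_iff Y_def)
        then show "q y \<in> \<Omega> - Y" using \<theta>q(1)[OF y] by simp
      qed
      show "\<Omega> - Y \<subseteq> q ` (S \<times> UNIV)"
      proof
        fix x assume x: "x \<in> \<Omega> - Y"
        let ?y = "((fst (\<theta> x), fst (snd (\<theta> x))), snd (snd (\<theta> x)))"
        have y: "?y \<in> S \<times> UNIV" using x \<theta>K[of x] by (simp add: S_def Y_def mem_Times_iff)
        have "\<theta> (q ?y) = \<theta> x" using \<theta>q(2)[OF y] by simp
        then have "q ?y = x" using \<theta>q(1)[OF y] x by (intro \<theta>_eqD[of "q ?y" x]) simp_all
        then show "x \<in> q ` (S \<times> UNIV)" using y by (metis imageI)
      qed
    qed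
  qed
  define \<eta> where "\<eta> = q \<circ> (g \<circ> p)"
  have \<eta>: "bij_betw \<eta> Y (\<Omega> - Y)"
    unfolding \<eta>_def by (rule bij_betw_trans[OF bij_betw_trans[OF p g] q])
  have \<eta>_\<rho>: "\<eta> (\<rho> l x) = \<rho> l (\<eta> x)" if "l \<in> L" "x \<in> Y" for l x
  proof (rule \<theta>_eqD)
    have x: "x \<in> \<Omega>" "p x \<in> L \<times> UNIV" using that bij_betw_apply[OF p] by (simp_all add: Y_def)
    have y: "g (p x) \<in> S \<times> UNIV" using bij_betw_apply[OF g x(2)] .
    have l: "\<rho> l x \<in> Y" using that Y_\<rho> x by simp
    then show "\<eta> (\<rho> l x) \<in> \<Omega>" using bij_betw_apply[OF \<eta> l] by simp
    have \<eta>x: "\<eta> x \<in> \<Omega>" using bij_betw_apply[OF \<eta> that(2)] by simp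
    then show "\<rho> l (\<eta> x) \<in> \<Omega>" using that \<rho>_closed by simp
    have "p (\<rho> l x) = map_prod ((\<otimes>\<^bsub>K\<^esub>) l) id (p x)" using that x \<theta>\<rho> by (simp add: p_def)
    then have "g (p (\<rho> l x)) = map_prod (map_prod ((\<otimes>\<^bsub>K\<^esub>) l) id) id (g (p x))"
      using g_mult[OF that(1), of "fst (p x)" "snd (p x)"] x
      by (simp add: mem_Times_iff map_prod_def split_beta)
    moreover have "g (p (\<rho> l x)) \<in> S \<times> UNIV" using bij_betw_apply[OF g bij_betw_apply[OF p l]] .
    ultimately have "\<theta> (\<eta> (\<rho> l x)) = map_prod ((\<otimes>\<^bsub>K\<^esub>) l) id (\<theta> (\<eta> x))"
      using \<theta>q(2) y by (simp add: \<eta>_def)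
    then show "\<theta> (\<eta> (\<rho> l x)) = \<theta> (\<rho> l (\<eta> x))" using \<theta>\<rho> \<eta>x that by simp
  qed
  define \<tau> where "\<tau> = (\<lambda>x\<in>\<Omega>. if x \<in> Y then \<eta> x else inv_into Y \<eta> x)"
  have YO: "Y \<subseteq> \<Omega>" by (auto simp: Y_def)
  note \<tau> = swap_involution[OF \<eta> YO, folded \<tau>_def]
  have \<tau>_\<rho>: "\<tau> (\<rho> l x) = \<rho> l (\<tau> x)" if "l \<in> L" "x \<in> \<Omega>" for l x
  proof (cases "x \<in> Y")
    case True
    then show ?thesis using that Y_\<rho> \<eta>_\<rho> \<rho>_closed by (simp add: \<tau>_def)
  next
    case False
    \<comment> \<open>the equivariance on \<^term>\<open>Y\<close> applies to \<^term>\<open>\<tau> x\<close>, and \<open>\<tau> (\<tau> x) = x\<close>\<close>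
    have \<tau>x: "\<tau> x \<in> Y" "\<tau> x \<in> \<Omega>" using \<tau>(3)[OF that(2)] False YO by blast+
    then have "\<tau> (\<rho> l (\<tau> x)) = \<rho> l x"
      using that Y_\<rho> \<eta>_\<rho> \<rho>_closed \<tau>(2)[OF that(2)] by (simp add: \<tau>_def)
    then show ?thesis using \<tau>(2)[OF \<rho>_closed[of l "\<tau> x"]] \<tau>x that by simp
  qed
  have \<rho>_Y: "\<rho> k x \<notin> Y" if "k \<in> carrier K - L" "x \<in> Y" for k x
    using that \<theta>\<rho>[of k x] mL'[of "fst (\<theta> x)" k] by (auto simp: Y_def)
  have sheet: "fst (snd x) = s" if "x \<in> Y" for x
    using that by (auto simp: Y_def \<theta>_def split_beta)
  show ?thesis
    by (intro exI[of _ \<rho>] exI[of _ \<tau>] exI[of _ Y] conjI ballI)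
      (simp_all add: \<rho> \<tau> YO \<rho>M \<tau>_\<rho> \<rho>_Y sheet)
qed

text \<open>Index \<open>i\<close> uses sheet \<open>Some i\<close> for \<open>Y i\<close>, and the base point lies in sheet \<open>None\<close>; as \<open>M\<close> preserves the
sheets, this separates the \<open>Y i\<close> and the orbit of the base point. The set \<open>Z\<close> of lists over the type
of \<open>K i \<times> 's\<close> absorbs that type by \<open>Cons\<close>.\<close>

lemma exists_ping_pong:
  fixes G M :: "'a monoid" and K :: "'i \<Rightarrow> 'a monoid" and L :: "'i \<Rightarrow> 'a set"
  assumes GM: "group_le G M" and MK: "\<And>i. i \<in> I \<Longrightarrow> group_le M (K i)"
    and L: "\<And>i. i \<in> I \<Longrightarrow> subgroup (L i) (K i)"
  obtains \<Omega> :: "('a \<times> 'i option \<times> ('a \<times> 'i option) list) set" and \<rho>\<^sub>M \<rho> \<tau> Y x\<^sub>0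
  where "ping_pong G I (\<lambda>i. carrier G \<inter> L i) \<Omega> \<rho>\<^sub>M \<tau> Y x\<^sub>0"
    "\<And>i. i \<in> I \<Longrightarrow> \<rho> i \<in> hom (K i) (BijGroup \<Omega>)"
    "\<And>i m. i \<in> I \<Longrightarrow> m \<in> carrier M \<Longrightarrow> \<rho> i m = \<rho>\<^sub>M m"
    "\<And>i l. i \<in> I \<Longrightarrow> l \<in> L i \<Longrightarrow> \<tau> i \<otimes>\<^bsub>BijGroup \<Omega>\<^esub> \<rho> i l = \<rho> i l \<otimes>\<^bsub>BijGroup \<Omega>\<^esub> \<tau> i"
proof -
  interpret G: group G by (rule group_leD[OF GM])
  interpret M: group M by (rule group_leD[OF GM])
  define \<Omega> where "\<Omega> = carrier M \<times> (UNIV :: ('i option \<times> ('a \<times> 'i option) list) set)"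
  define \<rho>\<^sub>M where "\<rho>\<^sub>M m = (\<lambda>x\<in>\<Omega>. map_prod ((\<otimes>\<^bsub>M\<^esub>) m) id x)" for m
  define P where "P i \<rho> \<tau> Y \<longleftrightarrow> \<rho> \<in> hom (K i) (BijGroup \<Omega>) \<and> \<tau> \<in> Bij \<Omega> \<and> Y \<subseteq> \<Omega> \<and>
    (\<forall>m\<in>carrier M. \<forall>x\<in>\<Omega>. \<rho> m x = map_prod ((\<otimes>\<^bsub>M\<^esub>) m) id x) \<and>
    (\<forall>x\<in>\<Omega>. \<tau> (\<tau> x) = x) \<and>
    (\<forall>l\<in>L i. \<forall>x\<in>\<Omega>. \<tau> (\<rho> l x) = \<rho> l (\<tau> x)) \<and>
    (\<forall>x\<in>\<Omega>. \<tau> x \<in> Y \<longleftrightarrow> x \<notin> Y) \<and>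
    (\<forall>k\<in>carrier (K i) - L i. \<forall>x\<in>Y. \<rho> k x \<notin> Y) \<and>
    (\<forall>x\<in>Y. fst (snd x) = Some i)" for i \<rho> \<tau> Y
  have "\<exists>\<rho> \<tau> Y. P i \<rho> \<tau> Y" if "i \<in> I" for i
  proof -
    have "inj (\<lambda>(p, z). p # z :: ('a \<times> 'i option) list)" by (auto intro: injI)
    from sheet_extension[OF MK[OF that] L[OF that] option.distinct(2)[of i] this]
    show ?thesis unfolding \<Omega>_def P_def .
  qed
  then obtain \<rho> \<tau> Y where P: "\<And>i. i \<in> I \<Longrightarrow> P i (\<rho> i) (\<tau> i) (Y i)" by metis
  have \<rho>: "\<And>i. i \<in> I \<Longrightarrow> \<rho> i \<in> hom (K i) (BijGroup \<Omega>)"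
    and \<tau>: "\<And>i. i \<in> I \<Longrightarrow> \<tau> i \<in> Bij \<Omega>" and Y: "\<And>i. i \<in> I \<Longrightarrow> Y i \<subseteq> \<Omega>"
    and \<rho>M: "\<And>i m x. i \<in> I \<Longrightarrow> m \<in> carrier M \<Longrightarrow> x \<in> \<Omega> \<Longrightarrow> \<rho> i m x = map_prod ((\<otimes>\<^bsub>M\<^esub>) m) id x"
    and \<tau>\<tau>: "\<And>i x. i \<in> I \<Longrightarrow> x \<in> \<Omega> \<Longrightarrow> \<tau> i (\<tau> i x) = x"
    and \<tau>\<rho>: "\<And>i l x. i \<in> I \<Longrightarrow> l \<in> L i \<Longrightarrow> x \<in> \<Omega> \<Longrightarrow> \<tau> i (\<rho> i l x) = \<rho> i l (\<tau> i x)"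
    and \<tau>Y: "\<And>i x. i \<in> I \<Longrightarrow> x \<in> \<Omega> \<Longrightarrow> \<tau> i x \<in> Y i \<longleftrightarrow> x \<notin> Y i"
    and \<rho>Y: "\<And>i k x. i \<in> I \<Longrightarrow> k \<in> carrier (K i) - L i \<Longrightarrow> x \<in> Y i \<Longrightarrow> \<rho> i k x \<notin> Y i"
    and sheet: "\<And>i x. i \<in> I \<Longrightarrow> x \<in> Y i \<Longrightarrow> fst (snd x) = Some i"
    using P unfolding P_def by blast+
  have "bij_betw id \<Omega> \<Omega>" by simp
  from M.translation_action_hom[OF this[unfolded \<Omega>_def]]
  have "(\<lambda>k. \<lambda>x\<in>\<Omega>. inv_into \<Omega> id (map_prod ((\<otimes>\<^bsub>M\<^esub>) k) id (id x))) \<in> hom M (BijGroup \<Omega>)"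
    by (simp only: \<Omega>_def)
  moreover have "(\<lambda>x\<in>\<Omega>. inv_into \<Omega> id (map_prod ((\<otimes>\<^bsub>M\<^esub>) k) id (id x))) = \<rho>\<^sub>M k"
    if "k \<in> carrier M" for k
    unfolding \<rho>\<^sub>M_def using that
    by (intro restrict_ext) (auto simp: \<Omega>_def intro!: inv_into_f_eq)
  ultimately have \<rho>\<^sub>M_hom: "\<rho>\<^sub>M \<in> hom M (BijGroup \<Omega>)"
    by (auto simp: hom_def Pi_iff)
  have agree: "\<rho> i m = \<rho>\<^sub>M m" if "i \<in> I" "m \<in> carrier M" for i m
    using hom_in_carrier[OF \<rho>[OF that(1)], of m] hom_in_carrier[OF \<rho>\<^sub>M_hom that(2)]
      group_leD(3)[OF MK[OF that(1)]] \<rho>M[OF that] that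
    by (intro Bij_eqI[of _ \<Omega>]) (auto simp: \<rho>\<^sub>M_def)
  have comm: "\<tau> i \<otimes>\<^bsub>BijGroup \<Omega>\<^esub> \<rho> i l = \<rho> i l \<otimes>\<^bsub>BijGroup \<Omega>\<^esub> \<tau> i" if "i \<in> I" "l \<in> L i" for i l
  proof -
    have "\<rho> i l \<in> Bij \<Omega>"
      using hom_in_carrier[OF \<rho>[OF that(1)]] subgroup.mem_carrier[OF L[OF that(1)] that(2)] by simp
    then show ?thesis
      using \<tau>[OF that(1)] \<tau>\<rho>[OF that] group.is_monoid[OF group_BijGroup, of \<Omega>, THEN monoid.m_closed]
      by (intro Bij_eqI[of _ \<Omega>]) (auto simp: BijGroup_mult_apply)
  qed
  have "ping_pong G I (\<lambda>i. carrier G \<inter> L i) \<Omega> \<rho>\<^sub>M \<tau> Y (\<one>\<^bsub>M\<^esub>, None, [])"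
  proof (intro ping_pong.intro ping_pong_axioms.intro)
    note GM' = group_leD(3)[OF GM]
    show "group G" by (rule G.is_group)
    show "subgroup (carrier G \<inter> L i) G" if "i \<in> I" for i
      using group_le_subgroup_Int[OF group_le_trans[OF GM MK] L] that by blast
    show "\<rho>\<^sub>M \<in> hom G (BijGroup \<Omega>)" using group_le_hom[OF GM \<rho>\<^sub>M_hom] .
    show "\<tau> i (\<rho>\<^sub>M a x) = \<rho>\<^sub>M a (\<tau> i x)" if "i \<in> I" "a \<in> carrier G \<inter> L i" "x \<in> \<Omega>" for i a x
      using \<tau>\<rho>[of i a x] agree[of i a] that GM' by auto
    show "\<rho>\<^sub>M g x \<notin> Y i" if "i \<in> I" "g \<in> carrier G - (carrier G \<inter> L i)" "x \<in> Y i" for i g x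
    proof -
      have "g \<in> carrier M" using that GM' by blast
      then have "g \<in> carrier (K i)" using group_leD(3)[OF MK[OF that(1)]] by blast
      then show ?thesis using \<rho>Y[of i g x] agree[of i g] that \<open>g \<in> carrier M\<close> by simp
    qed
    show "\<rho>\<^sub>M g x \<notin> Y j" if "i \<in> I" "j \<in> I" "i \<noteq> j" "g \<in> carrier G" "x \<in> Y i" for i j g x
      using that sheet[of i x] sheet[of j "\<rho>\<^sub>M g x"] Y[of i] by (auto simp: \<rho>\<^sub>M_def)
    show "(\<one>\<^bsub>M\<^esub>, None, []) \<in> \<Omega>" by (simp add: \<Omega>_def)
    show "g = \<one>\<^bsub>G\<^esub>" if "g \<in> carrier G" "\<rho>\<^sub>M g (\<one>\<^bsub>M\<^esub>, None, []) = (\<one>\<^bsub>M\<^esub>, None, [])" for g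
      using that GM' group_le_one[OF GM] by (auto simp: \<rho>\<^sub>M_def \<Omega>_def)
    show "\<rho>\<^sub>M g (\<one>\<^bsub>M\<^esub>, None, []) \<notin> Y i" if "i \<in> I" "g \<in> carrier G" for i g
      using that sheet[of i "\<rho>\<^sub>M g (\<one>\<^bsub>M\<^esub>, None, [])"] by (auto simp: \<rho>\<^sub>M_def \<Omega>_def)
  qed (fact \<tau> Y \<tau>\<tau> \<tau>Y)+
  then show thesis using that \<rho> agree comm by blast
qed

section \<open>Free products and reduced words\<close>

lemma pclass_letter_inv:
  assumes "wf_pres \<Delta>" "x \<in> fst \<Delta>"
  shows "pclass \<Delta> [(x, False)] = inv\<^bsub>pgroup \<Delta>\<^esub> (pclass \<Delta> [(x, True)])"
proof -
  interpret P: group "pgroup \<Delta>" by (rule group_pgroup[OF assms(1)])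
  have "([] @ [(x, False), (x, \<not> False)] @ [], [] @ []) \<in> word_rel \<Delta>"
    by (rule word_rel.cancel) (use assms in auto)
  then have "pclass \<Delta> [(x, False), (x, True)] = pclass \<Delta> []"
    using assms by (subst pclass_eq_iff) auto
  then have "pclass \<Delta> [(x, False)] \<otimes>\<^bsub>pgroup \<Delta>\<^esub> pclass \<Delta> [(x, True)] = \<one>\<^bsub>pgroup \<Delta>\<^esub>"
    using assms by (simp add: mult_pgroup one_pgroup)
  then show ?thesis using assms by (intro P.inv_equality[symmetric]) (auto simp: carrier_pgroup)
qed

lemma mult_table_hom:
  assumes wf: "wf_pres \<Delta>" and f: "f ` carrier H \<subseteq> fst \<Delta>" "mult_table f H \<subseteq> snd \<Delta>" and "group H"
  shows "(\<lambda>a. pclass \<Delta> [(f a, True)]) \<in> hom H (pgroup \<Delta>)"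
proof (rule homI)
  interpret H: group H by fact
  fix a b assume ab: "a \<in> carrier H" "b \<in> carrier H"
  then have m: "f a \<in> fst \<Delta>" "f b \<in> fst \<Delta>" "f (a \<otimes>\<^bsub>H\<^esub> b) \<in> fst \<Delta>" using f(1) by auto
  have "([(f a, True), (f b, True)], [(f (a \<otimes>\<^bsub>H\<^esub> b), True)]) \<in> snd \<Delta>"
    using f(2) ab by (auto simp: mult_table_def)
  then have "([] @ [(f a, True), (f b, True)] @ [], [] @ [(f (a \<otimes>\<^bsub>H\<^esub> b), True)] @ []) \<in> word_rel \<Delta>"
    by (intro word_rel.relation) auto
  then show "pclass \<Delta> [(f (a \<otimes>\<^bsub>H\<^esub> b), True)] =
      pclass \<Delta> [(f a, True)] \<otimes>\<^bsub>pgroup \<Delta>\<^esub> pclass \<Delta> [(f b, True)]"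
    using wf m by (simp add: mult_pgroup pclass_eq_iff word_rel.sym)
qed (use f(1) in \<open>auto simp: carrier_pgroup\<close>)

text \<open>By induction on the word: a letter in front of a reduced word is merged with the first syllable if
that has the same index, and a trivial syllable is dropped.\<close>

lemma free_product_reduced_representative:
  fixes X :: "'a monoid"
  assumes "group X" and B: "\<And>i. i \<in> I \<Longrightarrow> subgroup (B i) X"
  defines "\<Delta> \<equiv> free_product I (\<lambda>i. X\<lparr>carrier := B i\<rparr>)"
  assumes "u \<in> words (fst \<Delta>)"
  shows "\<exists>w\<in>reduced_words X I B. pclass \<Delta> u = pclass \<Delta> (syllables w)"
  using assms(4)
proof (induction u)
  case Nil
  then show ?case by (intro bexI[of _ "[]"]) (auto simp: reduced_words_def)
next
  case (Cons p u)
  interpret X: group X by fact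
  have wf: "wf_pres \<Delta>" unfolding \<Delta>_def
    using B by (intro wf_free_product) (auto intro: X.subgroup_imp_group)
  interpret P: group "pgroup \<Delta>" by (rule group_pgroup[OF wf])
  have gens: "fst \<Delta> = Sigma I B" by (simp add: \<Delta>_def free_product_def)
  obtain i b s where p: "p = ((i, b), s)" by (metis surj_pair)
  have ib: "i \<in> I" "b \<in> B i" and u: "u \<in> words (fst \<Delta>)" using Cons.prems by (auto simp: p gens)
  interpret Bi: subgroup "B i" X using B ib by blast
  interpret Bi': group "X\<lparr>carrier := B i\<rparr>" by (rule Bi.subgroup_is_group) (rule X.is_group)
  let ?c = "\<lambda>b. pclass \<Delta> [((i, b), True)]"
  have hom: "?c \<in> hom (X\<lparr>carrier := B i\<rparr>) (pgroup \<Delta>)"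
    using ib by (intro mult_table_hom[OF wf _ _ Bi'.is_group]) (auto simp: \<Delta>_def free_product_def)
  have c_mult: "?c (a \<otimes>\<^bsub>X\<^esub> b) = ?c a \<otimes>\<^bsub>pgroup \<Delta>\<^esub> ?c b" if "a \<in> B i" "b \<in> B i" for a b
    using hom_mult[OF hom, of a b] that by simp
  have c_one: "?c \<one>\<^bsub>X\<^esub> = \<one>\<^bsub>pgroup \<Delta>\<^esub>"
    using hom_one[OF hom Bi'.is_group P.is_group] by simp
  obtain b' where b': "b' \<in> B i" "pclass \<Delta> [p] = ?c b'"
  proof (cases s)
    case True
    then show thesis using that ib p by simp
  next
    case False
    interpret h: group_hom "X\<lparr>carrier := B i\<rparr>" "pgroup \<Delta>" ?c
      using hom Bi'.is_group P.is_group by (simp add: group_hom_def group_hom_axioms_def)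
    have "inv\<^bsub>X\<^esub> b \<in> B i" using ib by blast
    moreover have "?c (inv\<^bsub>X\<^esub> b) = pclass \<Delta> [p]"
      using h.hom_inv[of b] ib X.m_inv_consistent[OF B[OF ib(1)] ib(2)] p False
      by (simp add: pclass_letter_inv[OF wf] gens)
    ultimately show thesis using that by simp
  qed
  obtain w where w: "w \<in> reduced_words X I B" "pclass \<Delta> u = pclass \<Delta> (syllables w)"
    using Cons.IH u by blast
  have sw: "set v \<subseteq> Sigma I B" if "v \<in> reduced_words X I B" for v
    using that by (auto simp: reduced_words_def)
  have pu: "pclass \<Delta> (p # u) = ?c b' \<otimes>\<^bsub>pgroup \<Delta>\<^esub> pclass \<Delta> (syllables w)"
    using mult_pgroup[OF wf, of "[p]" u] u ib b' w p by (simp add: gens)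
  have step: "?c a \<otimes>\<^bsub>pgroup \<Delta>\<^esub> pclass \<Delta> (syllables v) = pclass \<Delta> (syllables ((i, a) # v))"
    if "a \<in> B i" "v \<in> reduced_words X I B" for a v
    using mult_pgroup[OF wf, of "[((i, a), True)]" "syllables v"] that sw ib by (simp add: gens)
  have closed: "?c a \<in> carrier (pgroup \<Delta>)" "pclass \<Delta> (syllables v) \<in> carrier (pgroup \<Delta>)"
    if "a \<in> B i" "v \<in> reduced_words X I B" for a v
    using that sw ib by (auto simp: carrier_pgroup gens)
  have attach: "\<exists>w'\<in>reduced_words X I B.
      ?c a \<otimes>\<^bsub>pgroup \<Delta>\<^esub> pclass \<Delta> (syllables v) = pclass \<Delta> (syllables w')"
    if "a \<in> B i" "v \<in> reduced_words X I B" "v \<noteq> [] \<longrightarrow> fst (hd v) \<noteq> i" for a v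
  proof (cases "a = \<one>\<^bsub>X\<^esub>")
    case True
    then have "?c a \<otimes>\<^bsub>pgroup \<Delta>\<^esub> pclass \<Delta> (syllables v) = pclass \<Delta> (syllables v)"
      using c_one closed(2)[OF that(1,2)] by simp
    then show ?thesis using that(2) by blast
  next
    case False
    then have "(i, a) # v \<in> reduced_words X I B" using that ib by (auto simp: reduced_words_Cons)
    then show ?thesis using step that by blast
  qed
  show ?case
  proof (cases "w \<noteq> [] \<and> fst (hd w) = i")
    case False
    then show ?thesis using attach[of b' w] b' w pu by auto
  next
    case True
    then obtain b2 v where v: "w = (i, b2) # v" by (cases w) auto
    then have v': "b2 \<in> B i" "v \<in> reduced_words X I B" "v \<noteq> [] \<longrightarrow> fst (hd v) \<noteq> i"
      using w by (auto simp: reduced_words_Cons)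
    have "pclass \<Delta> (p # u) = ?c b' \<otimes>\<^bsub>pgroup \<Delta>\<^esub> (?c b2 \<otimes>\<^bsub>pgroup \<Delta>\<^esub> pclass \<Delta> (syllables v))"
      using pu v step v' by simp
    also have "\<dots> = ?c (b' \<otimes>\<^bsub>X\<^esub> b2) \<otimes>\<^bsub>pgroup \<Delta>\<^esub> pclass \<Delta> (syllables v)"
      using closed v' b' c_mult by (simp add: P.m_assoc)
    finally show ?thesis using attach[of "b' \<otimes>\<^bsub>X\<^esub> b2" v] v' b' by auto
  qed
qed

lemma join_is_free_productI:
  fixes X :: "'a monoid"
  assumes "group X" and B: "\<And>i. i \<in> I \<Longrightarrow> subgroup (B i) X" and red: "reduced_words_nontrivial X I B"
  shows "join_is_free_product X I B"
proof -
  interpret X: group X by fact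
  let ?\<Delta> = "free_product I (\<lambda>i. X\<lparr>carrier := B i\<rparr>)"
  have wf: "wf_pres ?\<Delta>"
    using B by (intro wf_free_product) (auto intro: X.subgroup_imp_group)
  have mem: "a \<in> carrier X" if "i \<in> I" "a \<in> B i" for i a
    using B that subgroup.mem_carrier by metis
  then have resp: "compatible X ?\<Delta> snd"
    by (auto simp: compatible_def free_product_def mult_table_def)
  interpret h: group_hom "pgroup ?\<Delta>" X "lift X snd"
    using X.lift_hom[OF wf resp] group_pgroup[OF wf] X.is_group
    by (simp add: group_hom_def group_hom_axioms_def)
  have "C = \<one>\<^bsub>pgroup ?\<Delta>\<^esub>" if C: "C \<in> carrier (pgroup ?\<Delta>)" "lift X snd C = \<one>\<^bsub>X\<^esub>" for C
  proof -
    obtain u where u: "u \<in> words (fst ?\<Delta>)" "C = pclass ?\<Delta> u" using C by (auto simp: carrier_pgroup)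
    have "\<exists>w\<in>reduced_words X I B. pclass ?\<Delta> u = pclass ?\<Delta> (syllables w)"
      by (rule free_product_reduced_representative[OF assms(1) B u(1)])
    then obtain w where w: "w \<in> reduced_words X I B" "pclass ?\<Delta> u = pclass ?\<Delta> (syllables w)"
      by (elim bexE) (rule that)
    have "syllables w \<in> words (fst ?\<Delta>)"
      using w(1) by (auto simp: free_product_def reduced_words_def)
    then have "word_eval X snd (syllables w) = \<one>\<^bsub>X\<^esub>"
      using C(2) X.lift_pclass[OF wf resp] u(2) w(2) by simp
    then have "w = []" using red w by (auto simp: reduced_words_nontrivial_def)
    then show ?thesis using u(2) w(2) by (simp add: one_pgroup)
  qed
  then have "inj_on (lift X snd) (carrier (pgroup ?\<Delta>))" by (simp add: h.inj_on_one_iff)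
  then show ?thesis using join_is_free_product_iff[OF assms(1), of I B] B by simp
qed

context ping_pong
begin

lemma conj_action_mult:
  assumes "i \<in> I" "g \<in> carrier G" "h \<in> carrier G"
  shows "conj_action (i, g \<otimes> h) = conj_action (i, g) \<otimes>\<^bsub>BijGroup \<Omega>\<^esub> conj_action (i, h)"
proof (rule Bij_eqI)
  note B = conj_action_Bij[OF assms(1,2)] conj_action_Bij[OF assms(1,3)]
  show "conj_action (i, g \<otimes> h) \<in> Bij \<Omega>" using assms conj_action_Bij by simp
  show "conj_action (i, g) \<otimes>\<^bsub>BijGroup \<Omega>\<^esub> conj_action (i, h) \<in> Bij \<Omega>"
    using \<Omega>.m_closed B by simp
  fix x assume x: "x \<in> \<Omega>"
  have "\<tau> i x \<in> \<Omega>" "\<rho> h (\<tau> i x) \<in> \<Omega>" "\<tau> i (\<rho> h (\<tau> i x)) \<in> \<Omega>"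
    using x assms \<tau>_Bij \<rho>_Bij by (auto intro: Bij_apply)
  then show "conj_action (i, g \<otimes> h) x = (conj_action (i, g) \<otimes>\<^bsub>BijGroup \<Omega>\<^esub> conj_action (i, h)) x"
    using x assms B \<rho>_mult by (simp add: BijGroup_mult_apply conj_action_apply \<tau>_involution)
qed

text \<open>If \<open>\<Phi>\<close> represents \<open>X\<close> by the ping-pong permutations, then it maps a reduced word in the conjugates of
\<open>\<iota> G\<close> to the action of a reduced word over \<open>G\<close>, which is nontrivial.\<close>

lemma conjugates_free:
  fixes X :: "'x monoid"
  assumes red: "reduced_words_nontrivial G I A"
    and X: "group X" and \<iota>: "\<iota> \<in> hom G X" and t: "\<And>i. i \<in> I \<Longrightarrow> t i \<in> carrier X"
    and \<Phi>: "\<Phi> \<in> hom X (BijGroup \<Omega>)" "\<And>g. g \<in> carrier G \<Longrightarrow> \<Phi> (\<iota> g) = \<rho> g"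
      "\<And>i. i \<in> I \<Longrightarrow> \<Phi> (t i) = \<tau> i"
  shows "join_is_free_product X I (\<lambda>i. conjugate X (\<iota> ` carrier G) (t i))"
proof (rule join_is_free_productI[OF X])
  interpret X: group X by fact
  interpret \<iota>: group_hom G X \<iota> using \<iota> by unfold_locales
  interpret \<Phi>: group_hom X "BijGroup \<Omega>" \<Phi> using \<Phi>(1) by unfold_locales
  let ?B = "\<lambda>i. conjugate X (\<iota> ` carrier G) (t i)"
  define f where "f = (\<lambda>(i, g). (i, inv\<^bsub>X\<^esub> t i \<otimes>\<^bsub>X\<^esub> \<iota> g \<otimes>\<^bsub>X\<^esub> t i))"
  show sub: "subgroup (?B i) X" if "i \<in> I" for i
  proof -
    have "t i \<otimes>\<^bsub>X\<^esub> (inv\<^bsub>X\<^esub> t i \<otimes>\<^bsub>X\<^esub> z) = z" if "z \<in> carrier X" for z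
      using t[OF \<open>i \<in> I\<close>] that by (simp add: X.m_assoc[symmetric])
    then have "(\<lambda>x. inv\<^bsub>X\<^esub> t i \<otimes>\<^bsub>X\<^esub> x \<otimes>\<^bsub>X\<^esub> t i) \<in> hom X X"
      using t[OF that] by (intro homI) (simp_all add: X.m_assoc)
    then interpret c: group_hom X X "\<lambda>x. inv\<^bsub>X\<^esub> t i \<otimes>\<^bsub>X\<^esub> x \<otimes>\<^bsub>X\<^esub> t i" by unfold_locales
    show ?thesis unfolding conjugate_def
      by (rule c.subgroup_img_is_subgroup[OF \<iota>.img_is_subgroup])
  qed
  show "reduced_words_nontrivial X I ?B"
    unfolding reduced_words_nontrivial_def
  proof (intro ballI impI)
    fix w assume w: "w \<in> reduced_words X I ?B" and eval: "word_eval X snd (syllables w) = \<one>\<^bsub>X\<^esub>"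
    have "\<forall>p\<in>set w. \<exists>q\<in>I \<times> carrier G. p = f q"
      using w by (fastforce simp: reduced_words_def conjugate_def f_def)
    then obtain c where c: "\<And>p. p \<in> set w \<Longrightarrow> c p \<in> I \<times> carrier G \<and> f (c p) = p" by metis
    define w' where "w' = map c w"
    have w'_set: "set w' \<subseteq> I \<times> carrier G" unfolding w'_def set_map using c by blast
    have fw': "map f w' = w" using c by (simp add: w'_def map_idI)
    have "map fst w' = map fst (map f w')" by (simp add: f_def split_beta)
    then have fst_w': "map fst w' = map fst w" using fw' by simp
    have "g \<noteq> \<one>" if "(i, g) \<in> set w'" for i g
    proof
      assume "g = \<one>"
      then have "f (i, g) = (i, \<one>\<^bsub>X\<^esub>)" using that w'_set t by (auto simp: f_def)
      moreover have "f (i, g) \<in> set w" using fw' that by force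
      ultimately show False using w by (auto simp: reduced_words_def)
    qed
    then have w': "w' \<in> reduced_words G I (\<lambda>_. carrier G)"
      using w w'_set fst_w' by (fastforce simp: reduced_words_def)
    have "\<Phi> (word_eval X snd (syllables (map f v))) = conj_eval v \<and>
        word_eval X snd (syllables (map f v)) \<in> carrier X"
      if "set v \<subseteq> I \<times> carrier G" for v
      using that
      by (induction v) (auto simp: f_def conj_action_def t \<Phi>)
    then have "conj_eval w' = \<one>\<^bsub>BijGroup \<Omega>\<^esub>" using w'_set fw' eval by (metis \<Phi>.hom_one)
    then have "conj_eval w' x\<^sub>0 = x\<^sub>0" using x\<^sub>0 by (simp add: BijGroup_one_apply)
    then have "w' = []" using conj_eval_nontrivial[OF red w'] by blast
    then show "w = []" by (simp add: w'_def)
  qed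
qed

end

text \<open>This needs the fact that a nonempty reduced word is nontrivial in the external free product. For that,
ping-pong permutations with trivial subgroups \<open>L i\<close> are used: as there are no reduced words over
trivial groups other than the empty one, the assumption of \<open>conj_eval_nontrivial\<close> is vacuous, and
\<open>conj_action\<close> extends to a homomorphism on the external free product of the \<open>A i\<close> that separates
reduced words from the empty word.\<close>

lemma join_is_free_productD:
  fixes G :: "'a monoid"
  assumes "group G" and A: "\<And>i. i \<in> I \<Longrightarrow> subgroup (A i) G" and join: "join_is_free_product G I A"
  shows "reduced_words_nontrivial G I A"
  unfolding reduced_words_nontrivial_def
proof (intro ballI impI)
  fix w assume w: "w \<in> reduced_words G I A" and eval: "word_eval G snd (syllables w) = \<one>\<^bsub>G\<^esub>"
  interpret G: group G by fact
  have le: "group_le G G" using G.is_group by (simp add: group_le_def)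
  obtain \<Omega> :: "('a \<times> 'b option \<times> ('a \<times> 'b option) list) set" and \<rho> \<tau> Y x\<^sub>0
    where "ping_pong G I (\<lambda>i. carrier G \<inter> {\<one>\<^bsub>G\<^esub>}) \<Omega> \<rho> \<tau> Y x\<^sub>0"
    using exists_ping_pong[OF le le, of I "\<lambda>_. {\<one>\<^bsub>G\<^esub>}"] G.triv_subgroup by metis
  then interpret ping_pong G I "\<lambda>i. carrier G \<inter> {\<one>\<^bsub>G\<^esub>}" \<Omega> \<rho> \<tau> Y x\<^sub>0 .
  let ?\<Delta> = "free_product I (\<lambda>i. G\<lparr>carrier := A i\<rparr>)"
  have mem: "a \<in> carrier G" if "i \<in> I" "a \<in> A i" for i a
    using A that subgroup.mem_carrier by metis
  have wf: "wf_pres ?\<Delta>"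
    using A by (intro wf_free_product) (auto intro: G.subgroup_imp_group)
  have resp: "compatible G ?\<Delta> snd" using mem
    by (auto simp: compatible_def free_product_def mult_table_def)
  have resp': "compatible (BijGroup \<Omega>) ?\<Delta> conj_action"
    using mem conj_action_Bij conj_action_mult \<Omega>.m_closed[simplified] \<Omega>.r_one[simplified]
    by (auto simp: compatible_def free_product_def mult_table_def)
  have inj: "inj_on (lift G snd) (carrier (pgroup ?\<Delta>))"
    by (rule iffD1[OF join_is_free_product_iff[OF assms(1) A] join])
  have sw: "syllables w \<in> words (fst ?\<Delta>)" using w by (auto simp: reduced_words_def free_product_def)
  have "lift G snd (pclass ?\<Delta> (syllables w)) = lift G snd (pclass ?\<Delta> [])"
    using eval sw G.lift_pclass[OF wf resp] by simp
  then have "pclass ?\<Delta> (syllables w) = pclass ?\<Delta> []"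
    using inj sw by (auto dest!: inj_onD simp: carrier_pgroup)
  then have "conj_eval w = \<one>\<^bsub>BijGroup \<Omega>\<^esub>"
    using sw \<Omega>.lift_pclass[OF wf resp'] by (metis word_eval.simps(1) words_simps(1))
  then have "conj_eval w x\<^sub>0 = x\<^sub>0" using x\<^sub>0 by (simp add: BijGroup_one_apply)
  moreover have "reduced_words_nontrivial G I (\<lambda>i. carrier G \<inter> {\<one>\<^bsub>G\<^esub>})"
    by (auto simp: reduced_words_nontrivial_def reduced_words_def)
  moreover have "w \<in> reduced_words G I (\<lambda>_. carrier G)"
    using w mem by (fastforce simp: reduced_words_def)
  ultimately show "w = []" using conj_eval_nontrivial by blast
qed

section \<open>Universal properties\<close>

lemma hnn_base_hom:
  assumes "group G" "\<And>i. i \<in> I \<Longrightarrow> A i \<subseteq> carrier G"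
  shows "hnn_base G I A \<in> hom G (hnn G I A)"
  unfolding hnn_base_def[abs_def] hnn_def
  by (rule mult_table_hom[OF wf_hnn_pres[OF assms] _ _ assms(1)]) (auto simp: hnn_pres_def)

lemma group_hnn:
  assumes "group G" "\<And>i. i \<in> I \<Longrightarrow> A i \<subseteq> carrier G" shows "group (hnn G I A)"
  unfolding hnn_def by (rule group_pgroup[OF wf_hnn_pres[OF assms]])

lemma hnn_stable_closed: "i \<in> I \<Longrightarrow> hnn_stable G I A i \<in> carrier (hnn G I A)"
  by (auto simp: hnn_stable_def hnn_def carrier_pgroup hnn_pres_def)

lemma hnn_universal:
  assumes "group G" and A: "\<And>i. i \<in> I \<Longrightarrow> A i \<subseteq> carrier G" and "group X"
    and f: "f \<in> hom G X" and t: "\<And>i. i \<in> I \<Longrightarrow> t i \<in> carrier X"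
    and comm: "\<And>i a. i \<in> I \<Longrightarrow> a \<in> A i \<Longrightarrow> t i \<otimes>\<^bsub>X\<^esub> f a = f a \<otimes>\<^bsub>X\<^esub> t i"
  obtains \<Phi> where "\<Phi> \<in> hom (hnn G I A) X"
    "\<And>g. g \<in> carrier G \<Longrightarrow> \<Phi> (hnn_base G I A g) = f g"
    "\<And>i. i \<in> I \<Longrightarrow> \<Phi> (hnn_stable G I A i) = t i"
proof -
  interpret G: group G by fact
  interpret X: group X by fact
  interpret f: group_hom G X f using f by unfold_locales
  let ?\<Delta> = "hnn_pres G I A"
  have wf: "wf_pres ?\<Delta>" using assms(1) A by (rule wf_hnn_pres)
  have fA: "f a \<in> carrier X" if "i \<in> I" "a \<in> A i" for i a
    using f.hom_closed[OF subsetD[OF A[OF that(1)] that(2)]] .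
  have "inv\<^bsub>X\<^esub> t i \<otimes>\<^bsub>X\<^esub> (f a \<otimes>\<^bsub>X\<^esub> t i) = f a" if "i \<in> I" "a \<in> A i" for i a
  proof -
    have "inv\<^bsub>X\<^esub> t i \<otimes>\<^bsub>X\<^esub> (f a \<otimes>\<^bsub>X\<^esub> t i) = inv\<^bsub>X\<^esub> t i \<otimes>\<^bsub>X\<^esub> (t i \<otimes>\<^bsub>X\<^esub> f a)"
      using comm[OF that] by simp
    also have "\<dots> = f a" using t[OF that(1)] fA[OF that] by (simp add: X.m_assoc[symmetric])
    finally show ?thesis .
  qed
  then have resp: "compatible X ?\<Delta> (case_sum f t)"
    using t fA by (auto simp: compatible_def hnn_pres_def mult_table_def)
  show thesis
  proof (rule that)
    show "lift X (case_sum f t) \<in> hom (hnn G I A) X"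
      unfolding hnn_def by (rule X.lift_hom[OF wf resp])
    show "lift X (case_sum f t) (hnn_base G I A g) = f g" if "g \<in> carrier G" for g
      unfolding hnn_base_def using that
      by (subst X.lift_pclass[OF wf resp]) (auto simp: hnn_pres_def)
    show "lift X (case_sum f t) (hnn_stable G I A i) = t i" if "i \<in> I" for i
      unfolding hnn_stable_def using that t
      by (subst X.lift_pclass[OF wf resp]) (auto simp: hnn_pres_def)
  qed
qed

lemma image_group_universal:
  assumes "group P" "inj_on h (carrier P)" "f \<in> hom P X"
  shows "group (image_group h P)" "h \<in> hom P (image_group h P)"
    "\<exists>\<Phi>\<in>hom (image_group h P) X. \<forall>x\<in>carrier P. \<Phi> (h x) = f x"
proof -
  note iso = inj_imp_image_group_iso[OF assms(2)]
  show "group (image_group h P)" using group.inj_imp_image_group_is_group[OF assms(1,2)] .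
  show "h \<in> hom P (image_group h P)" using iso by (simp add: iso_def)
  have "inv_into (carrier P) h \<in> hom (image_group h P) P"
    using group.iso_set_sym[OF assms(1) iso] by (simp add: iso_def)
  then have "f \<circ> inv_into (carrier P) h \<in> hom (image_group h P) X" using assms(3) by (rule hom_compose)
  moreover have "\<forall>x\<in>carrier P. (f \<circ> inv_into (carrier P) h) (h x) = f x" using assms(2) by simp
  ultimately show "\<exists>\<Phi>\<in>hom (image_group h P) X. \<forall>x\<in>carrier P. \<Phi> (h x) = f x" by blast
qed

text \<open>A family of homomorphisms \<open>f i\<close> on the factors that agree on \<open>M\<close> extends to the iterated amalgam. The
other two claims are part of the induction because each step needs that the previous stage is a
group into which the factors map.\<close>

lemma iter_amalgam_universal:
  fixes P :: "nat \<Rightarrow> 'b monoid" and X :: "'x monoid"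
  assumes P: "\<And>i. i \<in> {1..r} \<Longrightarrow> group (P i)" and e: "\<And>i. i \<in> {1..r} \<Longrightarrow> e i \<in> M \<rightarrow> carrier (P i)"
    and X: "group X" and f: "\<And>i. i \<in> {1..r} \<Longrightarrow> f i \<in> hom (P i) X"
    and fe: "\<And>i m. i \<in> {1..r} \<Longrightarrow> m \<in> M \<Longrightarrow> f i (e i m) = f 1 (e 1 m)"
    and "1 \<le> n" "n \<le> r"
  shows "group (fst (iter_amalgam M e P n)) \<and>
    (\<forall>i\<in>{1..n}. snd (iter_amalgam M e P n) i \<in> hom (P i) (fst (iter_amalgam M e P n))) \<and>
    (\<exists>\<Phi>\<in>hom (fst (iter_amalgam M e P n)) X.
      \<forall>i\<in>{1..n}. \<forall>x\<in>carrier (P i). \<Phi> (snd (iter_amalgam M e P n) i x) = f i x)"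
  using assms(6,7)
proof (induction n rule: dec_induct)
  case base
  then have "group (P 1)" "f 1 \<in> hom (P 1) X" using P f by auto
  moreover have "inj_on Factor (carrier (P 1))" by (auto intro: inj_onI)
  ultimately show ?case using image_group_universal[of "P 1" Factor "f 1" X] by auto
next
  case (step n)
  then obtain k where k: "n = Suc k" by (cases n) auto
  let ?n = "Suc (Suc k)"
  let ?S = "fst (iter_amalgam M e P (Suc k))" and ?\<iota> = "snd (iter_amalgam M e P (Suc k))"
  let ?\<Delta> = "amalgam_pres ?S (P ?n) M (\<lambda>m. ?\<iota> 1 (e 1 m)) (e ?n)"
  interpret X: group X by fact
  have S: "group ?S" and \<iota>: "\<And>i. i \<in> {1..Suc k} \<Longrightarrow> ?\<iota> i \<in> hom (P i) ?S"
    and "\<exists>\<Phi>\<in>hom ?S X. \<forall>i\<in>{1..Suc k}. \<forall>x\<in>carrier (P i). \<Phi> (?\<iota> i x) = f i x"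
    using step k by auto
  then obtain \<Phi> where \<Phi>: "\<Phi> \<in> hom ?S X"
      "\<And>i x. i \<in> {1..Suc k} \<Longrightarrow> x \<in> carrier (P i) \<Longrightarrow> \<Phi> (?\<iota> i x) = f i x"
    by blast
  have n: "?n \<in> {1..r}" "1 \<in> {1..r}" using step.prems k by auto
  have \<iota>e: "?\<iota> 1 (e 1 m) \<in> carrier ?S" "e 1 m \<in> carrier (P 1)" "e ?n m \<in> carrier (P ?n)" if "m \<in> M" for m
  proof -
    show 1: "e 1 m \<in> carrier (P 1)" and "e ?n m \<in> carrier (P ?n)"
      using funcset_mem[OF e[OF n(2)] that] funcset_mem[OF e[OF n(1)] that] by simp_all
    show "?\<iota> 1 (e 1 m) \<in> carrier ?S" by (rule hom_in_carrier[OF \<iota> 1]) simp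
  qed
  have wf: "wf_pres ?\<Delta>" using S P n \<iota>e by (intro wf_amalgam_pres) auto
  have inS: "(\<lambda>x. pclass ?\<Delta> [(Inl x, True)]) \<in> hom ?S (pgroup ?\<Delta>)"
    by (rule mult_table_hom[OF wf _ _ S]) (auto simp: amalgam_pres_def)
  have inP: "(\<lambda>x. pclass ?\<Delta> [(Inr x, True)]) \<in> hom (P ?n) (pgroup ?\<Delta>)"
    by (rule mult_table_hom[OF wf _ _ P[OF n(1)]]) (auto simp: amalgam_pres_def)
  have "\<Phi> (?\<iota> 1 (e 1 m)) = f ?n (e ?n m)" if "m \<in> M" for m
    using \<Phi>(2)[of 1 "e 1 m"] \<iota>e(2)[OF that] fe[OF n(1) that] by simp
  then have resp: "compatible X ?\<Delta> (case_sum \<Phi> (f ?n))"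
    using \<iota>e(3) hom_in_carrier[OF \<Phi>(1)] hom_in_carrier[OF f[OF n(1)]]
      hom_mult[OF \<Phi>(1)] hom_mult[OF f[OF n(1)]]
    by (auto simp: compatible_def amalgam_pres_def mult_table_def)
  note E = image_group_universal[OF group_pgroup[OF wf] inj_on_encode[OF wf] X.lift_hom[OF wf resp]]
  obtain \<Psi> where \<Psi>: "\<Psi> \<in> hom (image_group encode (pgroup ?\<Delta>)) X"
      "\<And>x. x \<in> carrier (pgroup ?\<Delta>) \<Longrightarrow> \<Psi> (encode x) = lift X (case_sum \<Phi> (f ?n)) x"
    using E(3) by blast
  let ?\<iota>' = "\<lambda>i x. encode (pclass ?\<Delta> [(if i = ?n then Inr x else Inl (?\<iota> i x), True)])"
  have hom: "?\<iota>' i \<in> hom (P i) (image_group encode (pgroup ?\<Delta>))" if "i \<in> {1..?n}" for i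
  proof (cases "i = ?n")
    case True
    then show ?thesis using hom_compose[OF inP E(2)] by (simp add: comp_def)
  next
    case False
    then have "i \<in> {1..Suc k}" using that by auto
    then show ?thesis
      using False hom_compose[OF hom_compose[OF \<iota> inS] E(2)] by (simp add: comp_def)
  qed
  have eval: "\<Psi> (?\<iota>' i x) = f i x" if "i \<in> {1..?n}" "x \<in> carrier (P i)" for i x
  proof (cases "i = ?n")
    case True
    then have "[(Inr x, True)] \<in> words (fst ?\<Delta>)" using that by (simp add: amalgam_pres_def)
    moreover have "f ?n x \<in> carrier X" using True that n hom_in_carrier[OF f] by blast
    ultimately show ?thesis
      using True X.lift_pclass[OF wf resp, of "[(Inr x, True)]"] by (simp add: \<Psi>(2) carrier_pgroup)
  next
    case False
    then have i: "i \<in> {1..Suc k}" "i \<in> {1..r}" using that n by auto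
    then have "[(Inl (?\<iota> i x), True)] \<in> words (fst ?\<Delta>)"
      using that hom_in_carrier[OF \<iota>[of i], of x] by (simp add: amalgam_pres_def)
    moreover have "f i x \<in> carrier X" using that i hom_in_carrier[OF f] by blast
    ultimately show ?thesis
      using False i that \<Phi> X.lift_pclass[OF wf resp, of "[(Inl (?\<iota> i x), True)]"]
      by (simp add: \<Psi>(2) carrier_pgroup)
  qed
  show ?case
    unfolding k iter_amalgam.simps Let_def fst_conv snd_conv
    using E(1) hom eval \<Psi>(1) by blast
qed

section \<open>Free products of conjugates of the base group\<close>

theorem corollary4p6:
  fixes G :: "'a monoid" and A :: "nat \<Rightarrow> 'a set" and r :: nat
  assumes "1 \<le> r"
    and "group G"
    and "\<And>i. i \<in> {1..r} \<Longrightarrow> subgroup (A i) G"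
    and "join_is_free_product G {1..r} A"
  shows
    "join_is_free_product (hnn G {1..r} A) {1..r}
       (\<lambda>i. conjugate (hnn G {1..r} A) (hnn_base G {1..r} A ` carrier G)
              (hnn_stable G {1..r} A i))
     \<and>
     (\<forall>(M :: 'a monoid) (K :: nat \<Rightarrow> 'a monoid) (L :: nat \<Rightarrow> 'a set).
        group_le G M \<and>
        (\<forall>i\<in>{1..r}. group_le M (K i)) \<and>
        (\<forall>i\<in>{1..r}. \<forall>j\<in>{1..r}. i \<noteq> j \<longrightarrow> carrier (K i) \<inter> carrier (K j) = carrier M) \<and>
        (\<forall>i\<in>{1..r}. subgroup (L i) (K i)) \<and>
        (\<forall>i\<in>{1..r}. carrier G \<inter> L i = A i) \<longrightarrow>
        join_is_free_product (star M K L r) {1..r}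
          (\<lambda>i. conjugate (star M K L r) (star_base M K L r ` carrier G)
                 (star_stable M K L r i)))"
proof (intro conjI allI impI)
  let ?I = "{1..r}"
  interpret G: group G by fact
  note A = assms(3)
  note red = join_is_free_productD[OF assms(2) A assms(4)]
  have red_cong: "reduced_words_nontrivial G ?I B" if "\<And>i. i \<in> ?I \<Longrightarrow> B i = A i" for B
  proof -
    have "reduced_words G ?I B = reduced_words G ?I A"
      using that by (auto simp: reduced_words_def cong: Sigma_cong)
    then show ?thesis using red by (simp add: reduced_words_nontrivial_def)
  qed
  show "join_is_free_product (hnn G ?I A) ?I
      (\<lambda>i. conjugate (hnn G ?I A) (hnn_base G ?I A ` carrier G) (hnn_stable G ?I A i))"
  proof -
    \<comment> \<open>ping-pong permutations for \<open>M = K i = G\<close> and \<open>L i = A i\<close>\<close>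
    have le: "group_le G G" using G.is_group by (simp add: group_le_def)
    have AG: "A i \<subseteq> carrier G" if "i \<in> ?I" for i using subgroup.subset[OF A[OF that]] .
    obtain \<Omega> :: "('a \<times> nat option \<times> ('a \<times> nat option) list) set" and \<rho>\<^sub>G \<rho> \<tau> Y x\<^sub>0
      where pp: "ping_pong G ?I (\<lambda>i. carrier G \<inter> A i) \<Omega> \<rho>\<^sub>G \<tau> Y x\<^sub>0"
        and \<rho>: "\<And>i. i \<in> ?I \<Longrightarrow> \<rho> i \<in> hom G (BijGroup \<Omega>)"
        and agree: "\<And>i m. i \<in> ?I \<Longrightarrow> m \<in> carrier G \<Longrightarrow> \<rho> i m = \<rho>\<^sub>G m"
        and comm: "\<And>i l. i \<in> ?I \<Longrightarrow> l \<in> A i \<Longrightarrow>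
          \<tau> i \<otimes>\<^bsub>BijGroup \<Omega>\<^esub> \<rho> i l = \<rho> i l \<otimes>\<^bsub>BijGroup \<Omega>\<^esub> \<tau> i"
      by (rule exists_ping_pong[OF le le A]) (assumption | rule that)+
    interpret ping_pong G ?I "\<lambda>i. carrier G \<inter> A i" \<Omega> \<rho>\<^sub>G \<tau> Y x\<^sub>0 by (rule pp)
    have comm': "\<tau> i \<otimes>\<^bsub>BijGroup \<Omega>\<^esub> \<rho>\<^sub>G l = \<rho>\<^sub>G l \<otimes>\<^bsub>BijGroup \<Omega>\<^esub> \<tau> i" if "i \<in> ?I" "l \<in> A i" for i l
      using comm[OF that] agree[OF that(1), of l] AG[OF that(1)] that(2) by auto
    have \<tau>: "\<And>i. i \<in> ?I \<Longrightarrow> \<tau> i \<in> carrier (BijGroup \<Omega>)" using \<tau>_Bij by simp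
    obtain \<Phi> where \<Phi>: "\<Phi> \<in> hom (hnn G ?I A) (BijGroup \<Omega>)"
        "\<And>g. g \<in> carrier G \<Longrightarrow> \<Phi> (hnn_base G ?I A g) = \<rho>\<^sub>G g"
        "\<And>i. i \<in> ?I \<Longrightarrow> \<Phi> (hnn_stable G ?I A i) = \<tau> i"
      by (rule hnn_universal[OF G.is_group AG \<Omega>.is_group \<rho>_hom \<tau> comm']) (assumption | rule that)+
    show ?thesis
      using AG by (intro conjugates_free[OF red_cong group_hnn[OF G.is_group AG]
            hnn_base_hom[OF G.is_group AG] hnn_stable_closed \<Phi>]) auto
  qed
  fix M :: "'a monoid" and K :: "nat \<Rightarrow> 'a monoid" and L :: "nat \<Rightarrow> 'a set"
  assume "group_le G M \<and>
        (\<forall>i\<in>{1..r}. group_le M (K i)) \<and>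
        (\<forall>i\<in>{1..r}. \<forall>j\<in>{1..r}. i \<noteq> j \<longrightarrow> carrier (K i) \<inter> carrier (K j) = carrier M) \<and>
        (\<forall>i\<in>{1..r}. subgroup (L i) (K i)) \<and>
        (\<forall>i\<in>{1..r}. carrier G \<inter> L i = A i)"
  then have GM: "group_le G M" and MK: "\<And>i. i \<in> ?I \<Longrightarrow> group_le M (K i)"
    and L: "\<And>i. i \<in> ?I \<Longrightarrow> subgroup (L i) (K i)" and GL: "\<And>i. i \<in> ?I \<Longrightarrow> carrier G \<inter> L i = A i"
    by auto
  obtain \<Omega> :: "('a \<times> nat option \<times> ('a \<times> nat option) list) set" and \<rho>\<^sub>M \<rho> \<tau> Y x\<^sub>0
    where pp: "ping_pong G ?I (\<lambda>i. carrier G \<inter> L i) \<Omega> \<rho>\<^sub>M \<tau> Y x\<^sub>0"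
      and \<rho>: "\<And>i. i \<in> ?I \<Longrightarrow> \<rho> i \<in> hom (K i) (BijGroup \<Omega>)"
      and agree: "\<And>i m. i \<in> ?I \<Longrightarrow> m \<in> carrier M \<Longrightarrow> \<rho> i m = \<rho>\<^sub>M m"
      and comm: "\<And>i l. i \<in> ?I \<Longrightarrow> l \<in> L i \<Longrightarrow>
        \<tau> i \<otimes>\<^bsub>BijGroup \<Omega>\<^esub> \<rho> i l = \<rho> i l \<otimes>\<^bsub>BijGroup \<Omega>\<^esub> \<tau> i"
    by (rule exists_ping_pong[OF GM MK L]) (assumption | rule that)+
  interpret ping_pong G ?I "\<lambda>i. carrier G \<inter> L i" \<Omega> \<rho>\<^sub>M \<tau> Y x\<^sub>0 by (rule pp)
  note K = group_leD(2)[OF MK] and MK' = group_leD(3)[OF MK]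
  have LK: "L j \<subseteq> carrier (K i)" if "i \<in> ?I" "j \<in> {i}" for i j
    using subgroup.subset[OF L[OF that(1)]] that(2) by simp
  \<comment> \<open>each factor acts by \<open>\<rho> i\<close> on \<open>K i\<close> and by \<open>\<tau> i\<close> for the stable letter; the actions agree on \<open>M\<close>\<close>
  have ex_f: "\<exists>f. f \<in> hom (star_factor K L i) (BijGroup \<Omega>) \<and>
      (\<forall>k\<in>carrier (K i). f (hnn_base (K i) {i} L k) = \<rho> i k) \<and>
      f (hnn_stable (K i) {i} L i) = \<tau> i" if i: "i \<in> ?I" for i
  proof -
    have \<tau>: "\<And>j. j \<in> {i} \<Longrightarrow> \<tau> j \<in> carrier (BijGroup \<Omega>)" using \<tau>_Bij i by simp
    have comm': "\<And>j l. j \<in> {i} \<Longrightarrow> l \<in> L j \<Longrightarrow>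
        \<tau> j \<otimes>\<^bsub>BijGroup \<Omega>\<^esub> \<rho> i l = \<rho> i l \<otimes>\<^bsub>BijGroup \<Omega>\<^esub> \<tau> j" using comm i by simp
    obtain f where "f \<in> hom (hnn (K i) {i} L) (BijGroup \<Omega>)"
        "\<And>k. k \<in> carrier (K i) \<Longrightarrow> f (hnn_base (K i) {i} L k) = \<rho> i k"
        "\<And>j. j \<in> {i} \<Longrightarrow> f (hnn_stable (K i) {i} L j) = \<tau> j"
      by (rule hnn_universal[OF K[OF i] LK[OF i] \<Omega>.is_group \<rho>[OF i] \<tau> comm']) (assumption | rule that)+
    then show ?thesis unfolding star_factor_def by (intro exI[of _ f]) simp
  qed
  define f where "f i = (SOME f. f \<in> hom (star_factor K L i) (BijGroup \<Omega>) \<and>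
      (\<forall>k\<in>carrier (K i). f (hnn_base (K i) {i} L k) = \<rho> i k) \<and>
      f (hnn_stable (K i) {i} L i) = \<tau> i)" for i
  have f: "f i \<in> hom (star_factor K L i) (BijGroup \<Omega>)"
    and f_base: "k \<in> carrier (K i) \<Longrightarrow> f i (hnn_base (K i) {i} L k) = \<rho> i k"
    and f_stable: "f i (hnn_stable (K i) {i} L i) = \<tau> i" if "i \<in> ?I" for i k
    using someI_ex[OF ex_f[OF that]] by (simp_all add: f_def)
  have factor: "group (star_factor K L i)" "hnn_base (K i) {i} L \<in> hom (K i) (star_factor K L i)"
    if "i \<in> ?I" for i
    unfolding star_factor_def
    by (rule group_hnn[OF K[OF that] LK[OF that]], assumption,
        rule hnn_base_hom[OF K[OF that] LK[OF that]])
  have base_M: "hnn_base (K i) {i} L \<in> carrier M \<rightarrow> carrier (star_factor K L i)" if "i \<in> ?I" for i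
    using hom_in_carrier[OF factor(2)[OF that]] subsetD[OF MK'[OF that]] by (intro funcsetI) simp
  have one: "1 \<in> ?I" using assms(1) by simp
  have f_agree: "f i (hnn_base (K i) {i} L m) = f 1 (hnn_base (K 1) {1} L m)"
    if "i \<in> ?I" "m \<in> carrier M" for i m
    using f_base[OF that(1) subsetD[OF MK'[OF that(1)] that(2)]]
      f_base[OF one subsetD[OF MK'[OF one] that(2)]] agree that one by simp
  note U = iter_amalgam_universal[of r "star_factor K L" "\<lambda>i. hnn_base (K i) {i} L" "carrier M"
      "BijGroup \<Omega>" f r, OF factor(1) base_M \<Omega>.is_group f f_agree assms(1) order.refl,
      folded star_iter_def star_def]
  have \<iota>: "\<And>i. i \<in> ?I \<Longrightarrow> snd (star_iter M K L r) i \<in> hom (star_factor K L i) (star M K L r)"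
    using U by blast
  obtain \<Phi> where \<Phi>: "\<Phi> \<in> hom (star M K L r) (BijGroup \<Omega>)"
      "\<And>i x. i \<in> ?I \<Longrightarrow> x \<in> carrier (star_factor K L i) \<Longrightarrow> \<Phi> (snd (star_iter M K L r) i x) = f i x"
    using U by blast
  have base: "star_base M K L r \<in> hom G (star M K L r)"
  proof -
    have "star_base M K L r \<in> hom (K 1) (star M K L r)"
      using hom_compose[OF factor(2)[OF one] \<iota>[OF one]]
      by (simp add: star_base_def[abs_def] comp_def)
    then show ?thesis using group_le_hom[OF group_le_trans[OF GM MK[OF one]]] by blast
  qed
  have stable_in: "hnn_stable (K i) {i} L i \<in> carrier (star_factor K L i)" if "i \<in> ?I" for i
    unfolding star_factor_def by (rule hnn_stable_closed) simp
  show "join_is_free_product (star M K L r) ?I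
      (\<lambda>i. conjugate (star M K L r) (star_base M K L r ` carrier G) (star_stable M K L r i))"
  proof (rule conjugates_free[OF red_cong _ base _ \<Phi>(1)])
    show "group (star M K L r)" using U by blast
    show "star_stable M K L r i \<in> carrier (star M K L r)" if "i \<in> ?I" for i
      unfolding star_stable_def using hom_in_carrier[OF \<iota>[OF that] stable_in[OF that]] .
    show "\<Phi> (star_stable M K L r i) = \<tau> i" if "i \<in> ?I" for i
      unfolding star_stable_def using \<Phi>(2) stable_in f_stable that by simp
    show "\<Phi> (star_base M K L r g) = \<rho>\<^sub>M g" if "g \<in> carrier G" for g
    proof -
      have m: "g \<in> carrier M" using that group_leD(3)[OF GM] by blast
      then have "g \<in> carrier (K 1)" using MK'[OF one] by blast
      then show ?thesis
        using m one \<Phi>(2) base_M f_base agree by (simp add: star_base_def Pi_iff)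
    qed
  qed (use GL in auto)
qed

end
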